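(* Let $D\subseteq R$ be an extension of commutative integral domains such that $R$ is countably generated over $D$ (as a ring). If $D$ is productively bounded, then $R$ is productively bounded.
   Context: $R$ is countably generated over $D$ (as a ring) if there is a countable subset $S\subseteq R$ with $R=D[S]$, i.e. $R$ is countably generated as a $D$-algebra. Let $A$ be a commutative integral domain. An $A$-module $M$ is torsion if every element of $M$ is annihilated by some nonzero element of $A$; $\operatorname{ann}_A(M)=\{a\in A: aM=0\}$; the intersection of an empty family of ideals is $A$. A subset $J\subseteq I$ is cofinite if $I\setminus J$ is finite. $A$ is called productively bounded if, for every family $(M_i)_{i\in I}$ of torsion $A$-modules such that the direct product $\prod_{i\in I}M_i$ is torsion, there is a cofinite subset $J\subseteq I$ with $\bigcap_{i\in J}\operatorname{ann}_A(M_i)\neq 0$. *)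

theory Defs
  imports "HOL-Algebra.Algebra" "HOL-Library.Countable_Set" "HOL-Library.FuncSet"
begin

definition module_ann :: "('a, 'c) ring_scheme \<Rightarrow> ('a, 'm) module \<Rightarrow> 'a set" where
  "module_ann A M = {a \<in> carrier A. \<forall>x \<in> carrier M. a \<odot>\<^bsub>M\<^esub> x = \<zero>\<^bsub>M\<^esub>}"

definition torsion_module :: "('a, 'c) ring_scheme \<Rightarrow> ('a, 'm) module \<Rightarrow> bool" where
  "torsion_module A M \<longleftrightarrow>
     module A M \<and> (\<forall>x \<in> carrier M. \<exists>a \<in> carrier A - {\<zero>\<^bsub>A\<^esub>}. a \<odot>\<^bsub>M\<^esub> x = \<zero>\<^bsub>M\<^esub>)"

(* The module record extends the ring record, so mult and one have to be filled in;
   the locale module ignores them. *)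
definition product_module :: "'i set \<Rightarrow> ('i \<Rightarrow> ('a, 'm) module) \<Rightarrow> ('a, 'i \<Rightarrow> 'm) module" where
  "product_module I M =
     \<lparr> carrier = (\<Pi>\<^sub>E i\<in>I. carrier (M i)),
       monoid.mult = (\<lambda>f g. \<lambda>i\<in>I. f i \<otimes>\<^bsub>M i\<^esub> g i),
       monoid.one = (\<lambda>i\<in>I. \<one>\<^bsub>M i\<^esub>),
       ring.zero = (\<lambda>i\<in>I. \<zero>\<^bsub>M i\<^esub>),
       ring.add = (\<lambda>f g. \<lambda>i\<in>I. f i \<oplus>\<^bsub>M i\<^esub> g i),
       module.smult = (\<lambda>a f. \<lambda>i\<in>I. a \<odot>\<^bsub>M i\<^esub> f i) \<rparr>"

(* HOL cannot quantify over all types inside a formula, so the types 'i of the indices and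
   'm of the module elements are explicit parameters. For a domain A with elements of type
   'a, the instance in which both are 'a implies every other instance: see
   productively_bounded_universe below. Intersecting with carrier A makes the
   intersection over the empty family equal to A. *)
definition productively_bounded ::
    "'i itself \<Rightarrow> 'm itself \<Rightarrow> ('a, 'c) ring_scheme \<Rightarrow> bool" where
  "productively_bounded TI TM A \<longleftrightarrow>
     (\<forall>(I :: 'i set) (M :: 'i \<Rightarrow> ('a, 'm) module).
        (\<forall>i\<in>I. torsion_module A (M i)) \<and> torsion_module A (product_module I M) \<longrightarrow>
        (\<exists>J\<subseteq>I. finite (I - J) \<and> carrier A \<inter> (\<Inter>i\<in>J. module_ann A (M i)) \<noteq> {\<zero>\<^bsub>A\<^esub>}))"

lemma product_module_is_module:
  assumes A: "cring A" and M: "\<And>i. i \<in> I \<Longrightarrow> module A (M i)"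
  shows "module A (product_module I M)"
proof -
  have ab: "\<And>i. i \<in> I \<Longrightarrow> abelian_group (M i)"
    using M by (simp add: module_def)
  have cm: "\<And>i. i \<in> I \<Longrightarrow> abelian_monoid (M i)"
    using ab by (simp add: abelian_group.axioms)
  have "abelian_group (product_module I M)"
  proof (rule abelian_groupI)
    fix x y z assume xyz: "x \<in> carrier (product_module I M)" "y \<in> carrier (product_module I M)"
      "z \<in> carrier (product_module I M)"
    show "x \<oplus>\<^bsub>product_module I M\<^esub> y \<oplus>\<^bsub>product_module I M\<^esub> z =
        x \<oplus>\<^bsub>product_module I M\<^esub> (y \<oplus>\<^bsub>product_module I M\<^esub> z)"
      using xyz by (auto simp: product_module_def PiE_iff
          intro!: restrict_ext abelian_monoid.a_assoc[OF cm])
    show "x \<oplus>\<^bsub>product_module I M\<^esub> y = y \<oplus>\<^bsub>product_module I M\<^esub> x"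
      using xyz by (auto simp: product_module_def PiE_iff
          intro!: restrict_ext abelian_monoid.a_comm[OF cm])
  next
    fix x assume x: "x \<in> carrier (product_module I M)"
    show "\<zero>\<^bsub>product_module I M\<^esub> \<oplus>\<^bsub>product_module I M\<^esub> x = x"
      using x by (intro extensionalityI[of _ I])
        (auto simp: product_module_def PiE_iff abelian_monoid.l_zero[OF cm])
    show "\<exists>y\<in>carrier (product_module I M).
            y \<oplus>\<^bsub>product_module I M\<^esub> x = \<zero>\<^bsub>product_module I M\<^esub>"
      using x ab
      by (intro bexI[of _ "\<lambda>i\<in>I. \<ominus>\<^bsub>M i\<^esub> x i"])
        (auto simp: product_module_def PiE_iff abelian_group.l_neg abelian_group.a_inv_closed
          intro!: restrict_ext)
  qed (use cm in \<open>auto simp: product_module_def PiE_iff abelian_monoid.a_closed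
        abelian_monoid.zero_closed\<close>)
  then show ?thesis
    by (intro moduleI A)
      (auto simp: product_module_def PiE_iff module.smult_closed[OF M] module.smult_l_distr[OF M]
        module.smult_r_distr[OF M] module.smult_assoc1[OF M] module.smult_one[OF M]
        intro!: restrict_ext extensionalityI[of _ I])
qed

unbundle cardinal_syntax

lemma small_faithful_submodule:
  assumes M: "module A M" and inf: "infinite (carrier A)"
  obtains N where "submodule N A M" "|N| \<le>o |carrier A|"
    "\<And>a. \<lbrakk>a \<in> carrier A; \<And>x. x \<in> N \<Longrightarrow> a \<odot>\<^bsub>M\<^esub> x = \<zero>\<^bsub>M\<^esub>\<rbrakk> \<Longrightarrow> a \<in> module_ann A M"
proof -
  interpret module A M by (fact M)
  define x where "x a = (SOME y. y \<in> carrier M \<and> (a \<odot>\<^bsub>M\<^esub> y \<noteq> \<zero>\<^bsub>M\<^esub> \<or> a \<in> module_ann A M))" for a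
  have x: "x a \<in> carrier M \<and> (a \<odot>\<^bsub>M\<^esub> x a \<noteq> \<zero>\<^bsub>M\<^esub> \<or> a \<in> module_ann A M)"
    if "a \<in> carrier A" for a
    unfolding x_def by (rule someI_ex) (use that in \<open>auto simp: module_ann_def\<close>)
  define lin where "lin t = (case t of (a, y, z) \<Rightarrow> a \<odot>\<^bsub>M\<^esub> y \<oplus>\<^bsub>M\<^esub> z)" for t
  define step where "step Y = lin ` (carrier A \<times> Y \<times> Y)" for Y
  define S where "S n = (step ^^ n) (x ` carrier A \<union> {\<zero>\<^bsub>M\<^esub>})" for n
  have S0: "S 0 = x ` carrier A \<union> {\<zero>\<^bsub>M\<^esub>}" and SS: "S (Suc n) = step (S n)" for n
    by (auto simp: S_def)
  have Sc: "S n \<subseteq> carrier M" for n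
    by (induction n) (use x in \<open>auto simp: S0 SS step_def lin_def\<close>)
  have Sz: "\<zero>\<^bsub>M\<^esub> \<in> S n" for n
  proof (induction n)
    case (Suc n)
    then show ?case
      unfolding SS step_def
      by (intro image_eqI[of _ lin "(\<zero>\<^bsub>A\<^esub>, \<zero>\<^bsub>M\<^esub>, \<zero>\<^bsub>M\<^esub>)"]) (auto simp: lin_def)
  qed (simp add: S0)
  have linS: "a \<odot>\<^bsub>M\<^esub> y \<oplus>\<^bsub>M\<^esub> z \<in> S (Suc n)" if "a \<in> carrier A" "y \<in> S n" "z \<in> S n" for a y z n
    using that unfolding SS step_def by (intro image_eqI[of _ lin "(a, y, z)"]) (auto simp: lin_def)
  have Smono1: "S n \<subseteq> S (Suc n)" for n
  proof
    fix y assume "y \<in> S n"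
    then show "y \<in> S (Suc n)"
      using linS[of "\<one>\<^bsub>A\<^esub>" y n "\<zero>\<^bsub>M\<^esub>"] Sz[of n] Sc[of n] by auto
  qed
  have Smono: "S m \<subseteq> S n" if "m \<le> n" for m n
    using lift_Suc_mono_le[of S, OF Smono1 that] .
  have Scard: "|S n| \<le>o |carrier A|" for n
  proof (induction n)
    case 0
    have "|x ` carrier A| \<le>o |carrier A|" by (rule card_of_image)
    moreover have "|{\<zero>\<^bsub>M\<^esub>}| \<le>o |carrier A|"
      using inf by (simp add: card_of_ordLeq_infinite finite_ordLess_infinite2 ordLess_imp_ordLeq)
    ultimately show ?case
      unfolding S0 using inf by (intro card_of_Un_ordLeq_infinite) auto
  next
    case (Suc n)
    have "|S n \<times> S n| \<le>o |carrier A|"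
      by (rule card_of_Times_ordLeq_infinite[OF inf Suc Suc])
    then have "|carrier A \<times> S n \<times> S n| \<le>o |carrier A|"
      by (rule card_of_Times_ordLeq_infinite[OF inf card_of_refl[THEN ordIso_imp_ordLeq]])
    then show ?case
      unfolding SS step_def by (rule ordLeq_transitive[OF card_of_image])
  qed
  define N where "N = (\<Union>n. S n)"
  have Nlin: "a \<odot>\<^bsub>M\<^esub> y \<oplus>\<^bsub>M\<^esub> z \<in> N" if "a \<in> carrier A" "y \<in> N" "z \<in> N" for a y z
  proof -
    from that obtain k l where "y \<in> S k" "z \<in> S l" by (auto simp: N_def)
    then have "y \<in> S (max k l)" "z \<in> S (max k l)"
      using Smono[of k "max k l"] Smono[of l "max k l"] by auto
    then show ?thesis using linS[OF that(1)] unfolding N_def by blast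
  qed
  have Nc: "N \<subseteq> carrier M" and Nz: "\<zero>\<^bsub>M\<^esub> \<in> N"
    using Sc Sz by (auto simp: N_def)
  have Nsm: "a \<odot>\<^bsub>M\<^esub> y \<in> N" if "a \<in> carrier A" "y \<in> N" for a y
    using Nlin[OF that Nz] that Nc by auto
  have "submodule N A M"
  proof (rule submoduleI)
    fix y assume y: "y \<in> N"
    then have "\<ominus>\<^bsub>M\<^esub> y = (\<ominus>\<^bsub>A\<^esub> \<one>\<^bsub>A\<^esub>) \<odot>\<^bsub>M\<^esub> y"
      using Nc smult_l_minus[of "\<one>\<^bsub>A\<^esub>" y] by auto
    then show "\<ominus>\<^bsub>M\<^esub> y \<in> N" using Nsm[of "\<ominus>\<^bsub>A\<^esub> \<one>\<^bsub>A\<^esub>" y] y by simp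
  next
    fix y z assume "y \<in> N" "z \<in> N"
    then show "y \<oplus>\<^bsub>M\<^esub> z \<in> N" using Nlin[of "\<one>\<^bsub>A\<^esub>" y z] Nc by auto
  qed (use Nc Nz Nsm in auto)
  moreover have "|N| \<le>o |carrier A|"
    unfolding N_def using inf Scard
    by (intro card_of_UNION_ordLeq_infinite) (auto simp: infinite_iff_card_of_nat)
  moreover have "a \<in> module_ann A M"
    if "a \<in> carrier A" "\<And>y. y \<in> N \<Longrightarrow> a \<odot>\<^bsub>M\<^esub> y = \<zero>\<^bsub>M\<^esub>" for a
  proof -
    have "x a \<in> N" using that(1) S0 by (auto simp: N_def intro!: exI[of _ 0])
    then show ?thesis using x that by auto
  qed
  ultimately show ?thesis by (rule that)
qed

definition transport_module :: "('m \<Rightarrow> 'n) \<Rightarrow> ('a, 'm) module \<Rightarrow> ('a, 'n) module" where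
  "transport_module h M =
     (let g = inv_into (carrier M) h in
      \<lparr> carrier = h ` carrier M,
        monoid.mult = (\<lambda>u v. h (g u \<otimes>\<^bsub>M\<^esub> g v)),
        monoid.one = h \<one>\<^bsub>M\<^esub>,
        ring.zero = h \<zero>\<^bsub>M\<^esub>,
        ring.add = (\<lambda>u v. h (g u \<oplus>\<^bsub>M\<^esub> g v)),
        module.smult = (\<lambda>a u. h (a \<odot>\<^bsub>M\<^esub> g u)) \<rparr>)"

lemma transport_module_is_module:
  assumes M: "module A M" and h: "inj_on h (carrier M)"
  shows "module A (transport_module h M)"
proof -
  interpret module A M by (fact M)
  note [simp] = inv_into_f_f[OF h]
  have "abelian_group (transport_module h M)"
  proof (rule abelian_groupI)
    fix u assume "u \<in> carrier (transport_module h M)"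
    then obtain y where y: "y \<in> carrier M" "u = h y"
      by (auto simp: transport_module_def Let_def)
    then show "\<exists>v\<in>carrier (transport_module h M).
        v \<oplus>\<^bsub>transport_module h M\<^esub> u = \<zero>\<^bsub>transport_module h M\<^esub>"
      by (intro bexI[of _ "h (\<ominus>\<^bsub>M\<^esub> y)"])
        (auto simp: transport_module_def Let_def M.l_neg)
  qed (auto simp: transport_module_def Let_def M.a_ac)
  then show ?thesis
    by (intro moduleI R.is_cring)
      (auto simp: transport_module_def Let_def smult_l_distr smult_r_distr smult_assoc1)
qed

lemma productively_bounded_universe:
  fixes A :: "('a, 'c) ring_scheme"
  assumes A: "domain A" and pb: "productively_bounded TYPE('a) TYPE('a) A"
  shows "productively_bounded TYPE('i) TYPE('m) A"
  unfolding productively_bounded_def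
proof (intro allI impI, elim conjE)
  fix I :: "'i set" and M :: "'i \<Rightarrow> ('a, 'm) module"
  assume tM: "\<forall>i\<in>I. torsion_module A (M i)"
    and tP: "torsion_module A (product_module I M)"
  interpret A: domain A by (fact A)
  have mM: "module A (M i)" if "i \<in> I" for i
    using tM that by (auto simp: torsion_module_def)
  show "\<exists>J\<subseteq>I. finite (I - J) \<and> carrier A \<inter> (\<Inter>i\<in>J. module_ann A (M i)) \<noteq> {\<zero>\<^bsub>A\<^esub>}"
  proof (cases "finite (carrier A)")
    case True
    have U: "a \<in> Units A" if a: "a \<in> carrier A" "a \<noteq> \<zero>\<^bsub>A\<^esub>" for a
    proof -
      have "inj_on (\<lambda>b. a \<otimes>\<^bsub>A\<^esub> b) (carrier A)"
        using a by (auto simp: inj_on_def A.m_lcancel)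
      then have "(\<lambda>b. a \<otimes>\<^bsub>A\<^esub> b) ` carrier A = carrier A"
        using a True by (intro endo_inj_surj) auto
      then obtain b where "b \<in> carrier A" "a \<otimes>\<^bsub>A\<^esub> b = \<one>\<^bsub>A\<^esub>"
        by (metis A.one_closed imageE)
      then show ?thesis using a A.m_comm[of a b] unfolding Units_def by auto
    qed
    have "\<one>\<^bsub>A\<^esub> \<in> module_ann A (M i)" if i: "i \<in> I" for i
    proof -
      interpret Mi: module A "M i" by (rule mM[OF i])
      have "y = \<zero>\<^bsub>M i\<^esub>" if y: "y \<in> carrier (M i)" for y
      proof -
        obtain a where a: "a \<in> carrier A" "a \<noteq> \<zero>\<^bsub>A\<^esub>" "a \<odot>\<^bsub>M i\<^esub> y = \<zero>\<^bsub>M i\<^esub>"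
          using tM i y by (auto simp: torsion_module_def)
        have inv: "inv\<^bsub>A\<^esub> a \<in> carrier A" using U a by auto
        have "y = (inv\<^bsub>A\<^esub> a \<otimes>\<^bsub>A\<^esub> a) \<odot>\<^bsub>M i\<^esub> y"
          using U a y by (simp add: A.Units_l_inv)
        also have "\<dots> = \<zero>\<^bsub>M i\<^esub>"
          using a inv y by (simp add: Mi.smult_assoc1)
        finally show ?thesis .
      qed
      then show ?thesis by (auto simp: module_ann_def)
    qed
    then have "\<one>\<^bsub>A\<^esub> \<in> carrier A \<inter> (\<Inter>i\<in>I. module_ann A (M i))" by auto
    then have "carrier A \<inter> (\<Inter>i\<in>I. module_ann A (M i)) \<noteq> {\<zero>\<^bsub>A\<^esub>}"
      using A.one_not_zero by blast
    then show ?thesis by (intro exI[of _ I]) auto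
  next
    case inf: False
    show ?thesis
    proof (rule ccontr)
      assume no: "\<not> ?thesis"
      have infI: "infinite {i \<in> I. a \<notin> module_ann A (M i)}"
        if a: "a \<in> carrier A - {\<zero>\<^bsub>A\<^esub>}" for a
      proof
        assume fin: "finite {i \<in> I. a \<notin> module_ann A (M i)}"
        define J where "J = {i \<in> I. a \<in> module_ann A (M i)}"
        have "I - J = {i \<in> I. a \<notin> module_ann A (M i)}" by (auto simp: J_def)
        then have "finite (I - J)" using fin by simp
        moreover have "a \<in> carrier A \<inter> (\<Inter>i\<in>J. module_ann A (M i))"
          using a by (auto simp: J_def)
        ultimately show False using no a by (auto simp: J_def)
      qed
      have "\<exists>C. C \<subseteq> {i \<in> I. a \<notin> module_ann A (M i)} \<and> infinite C \<and> countable C"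
        if "a \<in> carrier A - {\<zero>\<^bsub>A\<^esub>}" for a
        using infinite_countable_subset'[OF infI[OF that]] by blast
      then obtain C where C: "\<And>a. a \<in> carrier A - {\<zero>\<^bsub>A\<^esub>} \<Longrightarrow>
          C a \<subseteq> {i \<in> I. a \<notin> module_ann A (M i)} \<and> infinite (C a) \<and> countable (C a)"
        by metis
      define I' where "I' = (\<Union>a\<in>carrier A - {\<zero>\<^bsub>A\<^esub>}. C a)"
      have "I' \<subseteq> I" using C unfolding I'_def by blast
      have "|I'| \<le>o |carrier A|"
        unfolding I'_def
      proof (rule card_of_UNION_ordLeq_infinite[OF inf])
        show "|carrier A - {\<zero>\<^bsub>A\<^esub>}| \<le>o |carrier A|" by (rule card_of_mono1) auto
        show "\<forall>a\<in>carrier A - {\<zero>\<^bsub>A\<^esub>}. |C a| \<le>o |carrier A|"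
        proof
          fix a assume "a \<in> carrier A - {\<zero>\<^bsub>A\<^esub>}"
          then have "|C a| \<le>o |UNIV :: nat set|"
            using C by (auto simp: countable_def card_of_ordLeq[symmetric])
          also have "|UNIV :: nat set| \<le>o |carrier A|"
            using inf by (simp add: infinite_iff_card_of_nat)
          finally show "|C a| \<le>o |carrier A|" .
        qed
      qed
      then obtain p :: "'i \<Rightarrow> 'a" where p: "inj_on p I'"
        unfolding card_of_ordLeq[symmetric] by blast
      define q where "q = inv_into I' p"
      have qp [simp]: "q (p i) = i" if "i \<in> I'" for i
        using p that by (simp add: q_def)
      have "\<exists>N. submodule N A (M i) \<and> |N| \<le>o |carrier A| \<and>
          (\<forall>a\<in>carrier A. (\<forall>y\<in>N. a \<odot>\<^bsub>M i\<^esub> y = \<zero>\<^bsub>M i\<^esub>) \<longrightarrow> a \<in> module_ann A (M i))"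
        if "i \<in> I" for i
        using small_faithful_submodule[OF mM[OF that] inf] by metis
      then obtain N where N: "\<And>i. i \<in> I \<Longrightarrow> submodule (N i) A (M i)"
        and Nc: "\<And>i. i \<in> I \<Longrightarrow> |N i| \<le>o |carrier A|"
        and Na: "\<And>i a. \<lbrakk>i \<in> I; a \<in> carrier A; \<And>y. y \<in> N i \<Longrightarrow> a \<odot>\<^bsub>M i\<^esub> y = \<zero>\<^bsub>M i\<^esub>\<rbrakk>
                  \<Longrightarrow> a \<in> module_ann A (M i)"
        by metis
      have "\<exists>h :: 'm \<Rightarrow> 'a. inj_on h (N i)" if "i \<in> I" for i
        using Nc[OF that] unfolding card_of_ordLeq[symmetric] by blast
      then obtain h :: "'i \<Rightarrow> 'm \<Rightarrow> 'a" where h: "\<And>i. i \<in> I \<Longrightarrow> inj_on (h i) (N i)"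
        by metis
      have Nsub: "N i \<subseteq> carrier (M i)" if "i \<in> I" for i
        using module.submoduleE(1)[OF mM[OF that] N[OF that]] .
      have Nsm: "a \<odot>\<^bsub>M i\<^esub> y \<in> N i" if "i \<in> I" "a \<in> carrier A" "y \<in> N i" for i a y
        using module.submoduleE(4)[OF mM N] that by auto
      have Nz: "\<zero>\<^bsub>M i\<^esub> \<in> N i" if "i \<in> I" for i
        using subgroup.one_closed[OF submodule.axioms(1)[OF N[OF that]]] by simp
      define T where "T i = transport_module (h i) (M i\<lparr>carrier := N i\<rparr>)" for i
      have T: "carrier (T i) = h i ` N i" "\<zero>\<^bsub>T i\<^esub> = h i \<zero>\<^bsub>M i\<^esub>" for i
        by (auto simp: T_def transport_module_def Let_def)
      have Tsm: "a \<odot>\<^bsub>T i\<^esub> h i y = h i (a \<odot>\<^bsub>M i\<^esub> y)" if "i \<in> I" "y \<in> N i" for i a y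
        using inv_into_f_f[OF h] that by (auto simp: T_def transport_module_def Let_def)
      have mT: "module A (T i)" if "i \<in> I" for i
        unfolding T_def
        by (intro transport_module_is_module submodule.submodule_is_module mM N that)
          (use h that in auto)
      have tT: "torsion_module A (T i)" if i: "i \<in> I" for i
        unfolding torsion_module_def
      proof (intro conjI mT i ballI)
        fix u assume "u \<in> carrier (T i)"
        then obtain y where y: "y \<in> N i" "u = h i y" by (auto simp: T)
        then obtain a where "a \<in> carrier A - {\<zero>\<^bsub>A\<^esub>}" "a \<odot>\<^bsub>M i\<^esub> y = \<zero>\<^bsub>M i\<^esub>"
          using tM i Nsub[OF i] unfolding torsion_module_def by blast
        then show "\<exists>a\<in>carrier A - {\<zero>\<^bsub>A\<^esub>}. a \<odot>\<^bsub>T i\<^esub> u = \<zero>\<^bsub>T i\<^esub>"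
          using y Tsm[OF i] by (intro bexI[of _ a]) (auto simp: T)
      qed
      define L where "L = p ` I'"
      have qL: "q j \<in> I" "q j \<in> I'" "p (q j) = j" if "j \<in> L" for j
        using that \<open>I' \<subseteq> I\<close> by (auto simp: L_def)
      have tP': "torsion_module A (product_module L (\<lambda>j. T (q j)))"
        unfolding torsion_module_def
      proof (intro conjI ballI product_module_is_module)
        fix f assume "f \<in> carrier (product_module L (\<lambda>j. T (q j)))"
        then have f: "\<And>j. j \<in> L \<Longrightarrow> f j \<in> h (q j) ` N (q j)"
          by (auto simp: product_module_def T PiE_iff)
        define y where "y j = inv_into (N (q j)) (h (q j)) (f j)" for j
        have y: "y j \<in> N (q j) \<and> f j = h (q j) (y j)" if "j \<in> L" for j
          unfolding y_def using inv_into_into[OF f[OF that]] f_inv_into_f[OF f[OF that]] by simp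
        define g where "g = (\<lambda>i\<in>I. if i \<in> I' then y (p i) else \<zero>\<^bsub>M i\<^esub>)"
        have "g i \<in> carrier (M i)" if "i \<in> I" for i
        proof (cases "i \<in> I'")
          case True
          then show ?thesis using y[of "p i"] Nsub[OF that] that by (auto simp: g_def L_def)
        next
          case False
          then show ?thesis using Nsub[OF that] Nz[OF that] that by (auto simp: g_def)
        qed
        then have "g \<in> carrier (product_module I M)"
          by (auto simp: product_module_def g_def)
        then obtain a where a: "a \<in> carrier A - {\<zero>\<^bsub>A\<^esub>}"
          "a \<odot>\<^bsub>product_module I M\<^esub> g = \<zero>\<^bsub>product_module I M\<^esub>"
          using tP unfolding torsion_module_def by blast
        have ag: "a \<odot>\<^bsub>M i\<^esub> g i = \<zero>\<^bsub>M i\<^esub>" if "i \<in> I" for i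
          using fun_cong[OF a(2), of i] that by (simp add: product_module_def)
        have "a \<odot>\<^bsub>T (q j)\<^esub> f j = \<zero>\<^bsub>T (q j)\<^esub>" if j: "j \<in> L" for j
        proof -
          have "g (q j) = y j" using qL[OF j] by (simp add: g_def)
          then have "a \<odot>\<^bsub>M (q j)\<^esub> y j = \<zero>\<^bsub>M (q j)\<^esub>" using ag[of "q j"] qL[OF j] by simp
          then show ?thesis using y[OF j] Tsm[of "q j" "y j" a] qL[OF j] by (simp add: T)
        qed
        then have "a \<odot>\<^bsub>product_module L (\<lambda>j. T (q j))\<^esub> f =
            \<zero>\<^bsub>product_module L (\<lambda>j. T (q j))\<^esub>"
          by (auto simp: product_module_def)
        with a show "\<exists>a\<in>carrier A - {\<zero>\<^bsub>A\<^esub>}. a \<odot>\<^bsub>product_module L (\<lambda>j. T (q j))\<^esub> f =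
            \<zero>\<^bsub>product_module L (\<lambda>j. T (q j))\<^esub>" by blast
      qed (use mT qL A.is_cring in auto)
      have "\<forall>j\<in>L. torsion_module A (T (q j))" using tT qL by auto
      then obtain J where J: "J \<subseteq> L" "finite (L - J)"
        "carrier A \<inter> (\<Inter>j\<in>J. module_ann A (T (q j))) \<noteq> {\<zero>\<^bsub>A\<^esub>}"
        using pb[unfolded productively_bounded_def, rule_format, of L "\<lambda>j. T (q j)"] tP' by auto
      have "\<zero>\<^bsub>A\<^esub> \<in> carrier A \<inter> (\<Inter>j\<in>J. module_ann A (T (q j)))"
      proof -
        have "\<zero>\<^bsub>A\<^esub> \<in> module_ann A (T (q j))" if "j \<in> J" for j
          using module.smult_l_null[OF mT] qL J(1) that by (auto simp: module_ann_def)
        then show ?thesis by auto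
      qed
      then obtain a where a: "a \<in> carrier A - {\<zero>\<^bsub>A\<^esub>}" "\<And>j. j \<in> J \<Longrightarrow> a \<in> module_ann A (T (q j))"
        using J(3) by blast
      have "p i \<in> L - J" if i: "i \<in> C a" for i
      proof -
        have iI: "i \<in> I" "a \<notin> module_ann A (M i)" and iI': "i \<in> I'"
          using C[OF a(1)] i a(1) by (auto simp: I'_def)
        have "p i \<notin> J"
        proof
          assume "p i \<in> J"
          then have ann: "a \<in> module_ann A (T i)" using a(2)[of "p i"] iI' by simp
          have "a \<odot>\<^bsub>M i\<^esub> y = \<zero>\<^bsub>M i\<^esub>" if y: "y \<in> N i" for y
          proof -
            have "h i (a \<odot>\<^bsub>M i\<^esub> y) = h i \<zero>\<^bsub>M i\<^esub>"
              using ann y Tsm[OF iI(1) y, of a] by (auto simp: module_ann_def T)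
            then show ?thesis
              using inj_onD[OF h[OF iI(1)]] Nsm[OF iI(1) _ y] Nz[OF iI(1)] a(1) by blast
          qed
          then show False using Na[OF iI(1)] a(1) iI(2) by blast
        qed
        then show ?thesis using iI' by (auto simp: L_def)
      qed
      then have "p ` C a \<subseteq> L - J" by auto
      then have "finite (p ` C a)" using J(2) finite_subset by blast
      moreover have "inj_on p (C a)"
        using p a(1) by (auto simp: I'_def intro: inj_on_subset)
      ultimately show False using finite_imageD C[OF a(1)] by blast
    qed
  qed
qed

unbundle no cardinal_syntax

end

theory Submission
  imports Defs
begin

text \<open>
  Productive boundedness of a domain implies a compactness property of its ideals: a set of ideals
  has a common nonzero element as soon as all its countable subsets do. (Apply the hypothesis to
  countably many copies of the module of countably supported elements of the product of the
  quotients by these ideals.) Since \<open>R\<close> is an increasing union of finitely generated \<open>D\<close>-modules,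
  the property passes from \<open>D\<close> to \<open>R\<close>.

  In a hypothetical counterexample over \<open>R\<close>, compactness first reduces to a countable index set.
  For a sequence \<open>L\<close> of submodules that no nonzero scalar kills eventually, compactness also gives
  scalars \<open>e i\<close> such that \<open>e i L i\<close> and \<open>{x \<in> L i. e i x = 0}\<close> both inherit this property.
  Iterating yields a decreasing chain of submodule sequences, the \<open>n\<close>-th scalar sequence killing
  all later terms, so that elements chosen along the chain can be added up to one element \<open>w\<close> of
  the product. Productive boundedness of \<open>D\<close> lets each choice make the annihilator of \<open>w\<close> avoid one more
  \<open>D\<close>-generator of \<open>R\<close>, so \<open>w\<close> is not torsion.
\<close>

subsection \<open>Countable meets of ideals\<close>

definition countable_meets_suffice :: "('a, 'c) ring_scheme \<Rightarrow> bool" where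
  "countable_meets_suffice A \<longleftrightarrow>
     (\<forall>B. (\<forall>b\<in>B. ideal b A) \<and>
          (\<forall>C\<subseteq>B. countable C \<longrightarrow> (\<exists>a\<in>carrier A - {\<zero>\<^bsub>A\<^esub>}. \<forall>b\<in>C. a \<in> b)) \<longrightarrow>
          (\<exists>a\<in>carrier A - {\<zero>\<^bsub>A\<^esub>}. \<forall>b\<in>B. a \<in> b))"

lemma countable_meets_sufficeD:
  assumes "countable_meets_suffice A"
    and "\<And>k. k \<in> K \<Longrightarrow> ideal (b k) A"
    and "\<And>C. \<lbrakk>C \<subseteq> K; countable C\<rbrakk> \<Longrightarrow> \<exists>a\<in>carrier A - {\<zero>\<^bsub>A\<^esub>}. \<forall>k\<in>C. a \<in> b k"
  obtains a where "a \<in> carrier A" "a \<noteq> \<zero>\<^bsub>A\<^esub>" "\<And>k. k \<in> K \<Longrightarrow> a \<in> b k"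
proof -
  have "\<exists>a\<in>carrier A - {\<zero>\<^bsub>A\<^esub>}. \<forall>c\<in>C. a \<in> c" if C: "C \<subseteq> b ` K" "countable C" for C
  proof -
    obtain C' where "countable C'" "C' \<subseteq> K" "C = b ` C'"
      using countable_subset_image[of C b K] C by blast
    then show ?thesis using assms(3)[of C'] by auto
  qed
  then have "\<exists>a\<in>carrier A - {\<zero>\<^bsub>A\<^esub>}. \<forall>c\<in>b ` K. a \<in> c"
    using assms(1)[unfolded countable_meets_suffice_def, rule_format, of "b ` K"] assms(2) by blast
  then show ?thesis using that by blast
qed

lemma (in cring) idealI_cring:
  assumes "b \<subseteq> carrier R" "\<zero> \<in> b"
    and "\<And>x y. \<lbrakk>x \<in> b; y \<in> b\<rbrakk> \<Longrightarrow> x \<oplus> y \<in> b"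
    and "\<And>a x. \<lbrakk>a \<in> carrier R; x \<in> b\<rbrakk> \<Longrightarrow> a \<otimes> x \<in> b"
  shows "ideal b R"
proof (rule idealI[OF ring_axioms])
  have "\<ominus> x \<in> b" if "x \<in> b" for x
    using assms(4)[of "\<ominus> \<one>" x] that assms(1) by (auto simp: l_minus)
  then show "subgroup b (add_monoid R)"
    using assms by (intro subgroup.intro) (auto simp: a_inv_def)
next
  fix a x assume "a \<in> b" "x \<in> carrier R"
  then show "x \<otimes> a \<in> b" "a \<otimes> x \<in> b"
    using assms(4)[of x a] assms(1) m_comm[of a x] by auto
qed

section \<open>Quotient modules and products with countable support\<close>

definition quotient_module :: "('a, 'c) ring_scheme \<Rightarrow> 'a set \<Rightarrow> ('a, 'a set) module" where
  "quotient_module A b =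
     \<lparr> carrier = carrier (A Quot b),
       monoid.mult = monoid.mult (A Quot b),
       monoid.one = monoid.one (A Quot b),
       ring.zero = ring.zero (A Quot b),
       ring.add = ring.add (A Quot b),
       module.smult = (\<lambda>a U. (b +>\<^bsub>A\<^esub> a) \<otimes>\<^bsub>(A Quot b)\<^esub> U) \<rparr>"

text \<open>The residue map is a ring homomorphism, so each module law for the action through cosets
  is a ring law of the quotient.\<close>

lemma quotient_module_is_module:
  assumes "cring A" "ideal b A"
  shows "module A (quotient_module A b)"
proof -
  interpret A: cring A by fact
  interpret b: ideal b A by fact
  interpret Q: cring "A Quot b" using b.quotient_is_cring assms(1) by blast
  interpret h: ring_hom_ring A "A Quot b" "(+>\<^bsub>A\<^esub>) b" by (rule b.rcos_ring_hom_ring)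
  have "abelian_group (quotient_module A b)"
    by (rule abelian_groupI) (auto simp: quotient_module_def Q.a_ac intro: Q.l_neg)
  then show ?thesis
    by (intro moduleI assms(1)) (auto simp: quotient_module_def Q.l_distr Q.r_distr Q.m_assoc)
qed

text \<open>The support of an element of \<open>T\<close> is a countable set of ideals, and a common
  nonzero member of them kills the element. Countably many elements still have a countable joint
  support, so the product of countably many copies of \<open>T\<close> is torsion as well. A nonzero
  \<open>a\<close> that kills almost all copies kills \<open>T\<close>, hence the residue class of
  one modulo each \<open>b\<close>, so it lies in every \<open>b\<close>.\<close>

lemma countable_meets_suffice_if_productively_bounded:
  fixes A :: "('a, 'c) ring_scheme"
  assumes "domain A" and pb: "productively_bounded TYPE(nat) TYPE('a set \<Rightarrow> 'a set) A"
  shows "countable_meets_suffice A"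
  unfolding countable_meets_suffice_def
proof (intro allI impI, elim conjE)
  interpret A: domain A by fact
  fix B assume id: "\<forall>b\<in>B. ideal b A"
    and meet: "\<forall>C\<subseteq>B. countable C \<longrightarrow> (\<exists>a\<in>carrier A - {\<zero>\<^bsub>A\<^esub>}. \<forall>b\<in>C. a \<in> b)"
  define P where "P = product_module B (quotient_module A)"
  interpret P: module A P
    unfolding P_def using id by (intro product_module_is_module quotient_module_is_module A.is_cring) auto
  \<comment> \<open>The ideal \<open>b\<close> is itself the zero coset of \<open>A Quot b\<close>,
    so \<open>f b \<noteq> b\<close> says that the coordinate of \<open>f\<close> at
    \<open>b\<close> is nonzero.\<close>
  define supp where "supp f = {b \<in> B. f b \<noteq> b}" for f :: "'a set \<Rightarrow> 'a set"
  define N where "N = {f \<in> carrier P. countable (supp f)}"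
  have Pz: "\<zero>\<^bsub>P\<^esub> = (\<lambda>b\<in>B. b)"
    by (auto simp: P_def product_module_def quotient_module_def FactRing_def)
  have add0: "b <+>\<^bsub>A\<^esub> b = b" if b: "b \<in> B" for b
  proof -
    interpret module A "quotient_module A b"
      using b id by (intro quotient_module_is_module A.is_cring) auto
    show ?thesis using l_zero[OF zero_closed] by (simp add: quotient_module_def FactRing_def)
  qed
  have "supp (f \<oplus>\<^bsub>P\<^esub> g) \<subseteq> supp f \<union> supp g" for f g
    using add0 by (auto simp: supp_def P_def product_module_def quotient_module_def FactRing_def)
  moreover have "supp (a \<odot>\<^bsub>P\<^esub> f) \<subseteq> supp f" if "a \<in> carrier A" for a f
  proof
    fix b assume b: "b \<in> supp (a \<odot>\<^bsub>P\<^esub> f)"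
    interpret module A "quotient_module A b"
      using b id by (intro quotient_module_is_module A.is_cring) (auto simp: supp_def)
    have "a \<odot>\<^bsub>quotient_module A b\<^esub> b = b"
      using smult_r_null[OF that] by (simp add: quotient_module_def FactRing_def)
    with b show "b \<in> supp f"
      by (auto simp: supp_def P_def product_module_def)
  qed
  ultimately have "countable (supp (f \<oplus>\<^bsub>P\<^esub> g))" "countable (supp (a \<odot>\<^bsub>P\<^esub> f))"
    if "countable (supp f)" "countable (supp g)" "a \<in> carrier A" for f g a
    using that by (meson countable_Un countable_subset)+
  then have N_add: "f \<oplus>\<^bsub>P\<^esub> g \<in> N" and N_smult: "a \<odot>\<^bsub>P\<^esub> f \<in> N"
    if "f \<in> N" "g \<in> N" "a \<in> carrier A" for f g a
    using that unfolding N_def by auto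
  have "supp \<zero>\<^bsub>P\<^esub> = {}" by (auto simp: supp_def Pz)
  then have N_zero: "\<zero>\<^bsub>P\<^esub> \<in> N" by (simp add: N_def)
  have "submodule N A P"
  proof (rule P.submoduleI)
    fix f assume f: "f \<in> N"
    have "(\<ominus>\<^bsub>A\<^esub> \<one>\<^bsub>A\<^esub>) \<odot>\<^bsub>P\<^esub> f = \<ominus>\<^bsub>P\<^esub> f"
      using f P.smult_l_minus[of "\<one>\<^bsub>A\<^esub>" f] by (auto simp: N_def)
    then show "\<ominus>\<^bsub>P\<^esub> f \<in> N" using N_smult[OF f f, of "\<ominus>\<^bsub>A\<^esub> \<one>\<^bsub>A\<^esub>"] by simp
  qed (use N_zero N_add N_smult in \<open>auto simp: N_def\<close>)
  define T where "T = P\<lparr>carrier := N\<rparr>"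
  have mT: "module A T"
    unfolding T_def by (intro submodule.submodule_is_module[OF \<open>submodule N A P\<close>] P.module_axioms)
  have kill: "a \<odot>\<^bsub>P\<^esub> f = \<zero>\<^bsub>P\<^esub>"
    if a: "a \<in> carrier A" "\<And>b. b \<in> supp f \<Longrightarrow> a \<in> b" and f: "f \<in> carrier P" for a f
  proof -
    have "a \<odot>\<^bsub>quotient_module A b\<^esub> f b = \<zero>\<^bsub>quotient_module A b\<^esub>" if b: "b \<in> B" for b
    proof -
      interpret b: ideal b A using id b by blast
      interpret module A "quotient_module A b"
        using b id by (intro quotient_module_is_module A.is_cring) (auto simp: supp_def)
      have fb: "f b \<in> carrier (quotient_module A b)"
        using f b by (auto simp: P_def product_module_def)
      show ?thesis
      proof (cases "f b = b")
        case True
        then show ?thesis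
          using smult_r_null[OF a(1)] by (simp add: quotient_module_def FactRing_def)
      next
        case False
        then have "a \<in> b" using a(2) b by (auto simp: supp_def)
        then have "b +>\<^bsub>A\<^esub> a = b +>\<^bsub>A\<^esub> \<zero>\<^bsub>A\<^esub>" 
          by (metis A.a_coset_add_zero b.a_rcos_const b.a_subset)
        then have "a \<odot>\<^bsub>quotient_module A b\<^esub> f b = \<zero>\<^bsub>A\<^esub> \<odot>\<^bsub>quotient_module A b\<^esub> f b"
          by (simp add: quotient_module_def)
        then show ?thesis using smult_l_null[OF fb] by simp
      qed
    qed
    then show ?thesis by (auto simp: P_def product_module_def intro: restrict_ext)
  qed
  have "torsion_module A T"
    unfolding torsion_module_def
  proof (intro conjI mT ballI)
    fix f assume "f \<in> carrier T"
    then have f: "f \<in> carrier P" "countable (supp f)" by (auto simp: T_def N_def)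
    then obtain a where "a \<in> carrier A - {\<zero>\<^bsub>A\<^esub>}" "\<forall>b\<in>supp f. a \<in> b"
      using meet[rule_format, of "supp f"] by (auto simp: supp_def)
    then show "\<exists>a\<in>carrier A - {\<zero>\<^bsub>A\<^esub>}. a \<odot>\<^bsub>T\<^esub> f = \<zero>\<^bsub>T\<^esub>"
      using kill[of a f] f by (auto simp: T_def)
  qed
  moreover have "torsion_module A (product_module UNIV (\<lambda>n::nat. T))"
    unfolding torsion_module_def
  proof (intro conjI ballI)
    show "module A (product_module UNIV (\<lambda>n::nat. T))"
      by (intro product_module_is_module A.is_cring mT)
    fix F assume "F \<in> carrier (product_module UNIV (\<lambda>n::nat. T))"
    then have F: "F n \<in> carrier P" "countable (supp (F n))" for n
      by (auto simp: product_module_def T_def N_def)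
    have "(\<Union>n. supp (F n)) \<subseteq> B" "countable (\<Union>n. supp (F n))"
      using F by (auto simp: supp_def)
    then obtain a where a: "a \<in> carrier A - {\<zero>\<^bsub>A\<^esub>}" "\<forall>b\<in>(\<Union>n. supp (F n)). a \<in> b"
      using meet by meson
    then have "a \<odot>\<^bsub>P\<^esub> F n = \<zero>\<^bsub>P\<^esub>" for n using kill[of a "F n"] F by auto
    then show "\<exists>a\<in>carrier A - {\<zero>\<^bsub>A\<^esub>}. a \<odot>\<^bsub>product_module UNIV (\<lambda>n::nat. T)\<^esub> F =
        \<zero>\<^bsub>product_module UNIV (\<lambda>n::nat. T)\<^esub>"
      using a(1) by (intro bexI[of _ a]) (auto simp: product_module_def T_def)
  qed
  ultimately obtain J :: "nat set" where J: "finite (UNIV - J)"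
    "carrier A \<inter> (\<Inter>n\<in>J. module_ann A T) \<noteq> {\<zero>\<^bsub>A\<^esub>}"
    using pb[unfolded productively_bounded_def, rule_format, of UNIV "\<lambda>n. T"] by auto
  \<comment> \<open>The intersection over \<open>J\<close> equals the annihilator of
    \<open>T\<close> only for nonempty \<open>J\<close>; a cofinite set of naturals is
    nonempty.\<close>
  have "J \<noteq> {}" using J(1) by auto
  moreover have "\<zero>\<^bsub>A\<^esub> \<in> module_ann A T"
    using module.smult_l_null[OF mT] by (auto simp: module_ann_def)
  ultimately obtain a where a: "a \<in> carrier A - {\<zero>\<^bsub>A\<^esub>}" "a \<in> module_ann A T"
    using J(2) by (auto simp: module_ann_def)
  have "a \<in> b" if b: "b \<in> B" for b
  proof -
    interpret b: ideal b A using id b by blast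
    have Qz: "\<zero>\<^bsub>(A Quot b)\<^esub> = b" by (simp add: FactRing_def)
    interpret h: ring_hom_ring A "A Quot b" "(+>\<^bsub>A\<^esub>) b" by (rule b.rcos_ring_hom_ring)
    \<comment> \<open>The residue class of one in the coordinate \<open>b\<close>, and the zero
      coset in every other coordinate.\<close>
    define f where "f = (\<lambda>c\<in>B. if c = b then b +>\<^bsub>A\<^esub> \<one>\<^bsub>A\<^esub> else c)"
    have "c \<in> carrier (quotient_module A c)" if "c \<in> B" for c
    proof -
      interpret module A "quotient_module A c"
        using that id by (intro quotient_module_is_module A.is_cring) auto
      show ?thesis using zero_closed by (simp add: quotient_module_def FactRing_def)
    qed
    moreover have "b +>\<^bsub>A\<^esub> \<one>\<^bsub>A\<^esub> \<in> carrier (quotient_module A b)"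
      using h.hom_closed[OF A.one_closed] by (simp add: quotient_module_def)
    ultimately have "f \<in> carrier P"
      by (auto simp: f_def P_def product_module_def)
    moreover have "supp f \<subseteq> {b}" by (auto simp: f_def supp_def)
    then have "countable (supp f)" by (rule countable_subset) simp
    ultimately have "f \<in> carrier T" by (simp add: T_def N_def)
    then have "a \<odot>\<^bsub>P\<^esub> f = \<zero>\<^bsub>P\<^esub>" using a(2) by (auto simp: module_ann_def T_def)
    from fun_cong[OF \<open>a \<odot>\<^bsub>P\<^esub> f = \<zero>\<^bsub>P\<^esub>\<close>, of b] have "b +>\<^bsub>A\<^esub> a = b"
      using b a(1) h.hom_mult[of a "\<one>\<^bsub>A\<^esub>"]
      by (simp add: Pz Qz P_def product_module_def quotient_module_def f_def)
    then show ?thesis using a(1) b.rcos_const_imp_mem by auto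
  qed
  then show "\<exists>a\<in>carrier A - {\<zero>\<^bsub>A\<^esub>}. \<forall>b\<in>B. a \<in> b" using a(1) by blast
qed

subsection \<open>Countably generated extensions of domains\<close>

lemma (in cring) add_minus_add:
  assumes "x \<in> carrier R" "y \<in> carrier R" "z \<in> carrier R"
  shows "(x \<oplus> z) \<ominus> (y \<oplus> z) = x \<ominus> y"
proof -
  have "(x \<oplus> z) \<ominus> (y \<oplus> z) = (x \<oplus> \<ominus> y) \<oplus> (z \<oplus> \<ominus> z)"
    using assms by (simp add: a_minus_def minus_add a_ac)
  then show ?thesis using assms by (simp add: r_neg) (simp add: a_minus_def)
qed

locale domain_extension = domain R for R (structure) +
  fixes D :: "'a set"
  assumes subdomain: "subdomain D R"
begin

lemma D_carrier [simp, intro]: "d \<in> D \<Longrightarrow> d \<in> carrier R"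
  and D_zero [simp, intro]: "\<zero> \<in> D"
  and D_one [simp, intro]: "\<one> \<in> D"
  and D_minus [simp, intro]: "d \<in> D \<Longrightarrow> \<ominus> d \<in> D"
  and D_mult [simp, intro]: "\<lbrakk>d \<in> D; d' \<in> D\<rbrakk> \<Longrightarrow> d \<otimes> d' \<in> D"
  and D_add [simp, intro]: "\<lbrakk>d \<in> D; d' \<in> D\<rbrakk> \<Longrightarrow> d \<oplus> d' \<in> D"
  using subdomainE[OF subdomain] by auto

text \<open>The index counts generators: \<open>D_span s n\<close> involves \<open>s i\<close> for
  \<open>i < n\<close> only.\<close>

fun D_span :: "(nat \<Rightarrow> 'a) \<Rightarrow> nat \<Rightarrow> 'a set" where
  "D_span s 0 = {\<zero>}"
| "D_span s (Suc n) = (\<lambda>(v, d). v \<oplus> d \<otimes> s n) ` (D_span s n \<times> D)"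

text \<open>These are the \<open>D\<close>-submodules of \<open>R\<close>; closure under negation
  comes from multiplication by \<open>\<ominus> \<one>\<close>, which lies in
  \<open>D\<close>.\<close>

definition D_subspace :: "'a set \<Rightarrow> bool" where
  "D_subspace A \<longleftrightarrow> A \<subseteq> carrier R \<and> \<zero> \<in> A \<and> (\<forall>x\<in>A. \<forall>y\<in>A. x \<oplus> y \<in> A) \<and>
     (\<forall>d\<in>D. \<forall>x\<in>A. d \<otimes> x \<in> A)"

lemma D_subspaceD:
  assumes "D_subspace A"
  shows "A \<subseteq> carrier R" "\<zero> \<in> A" "\<And>x y. \<lbrakk>x \<in> A; y \<in> A\<rbrakk> \<Longrightarrow> x \<oplus> y \<in> A"
    "\<And>d x. \<lbrakk>d \<in> D; x \<in> A\<rbrakk> \<Longrightarrow> d \<otimes> x \<in> A" "\<And>x y. \<lbrakk>x \<in> A; y \<in> A\<rbrakk> \<Longrightarrow> x \<ominus> y \<in> A"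
proof -
  show A: "A \<subseteq> carrier R" "\<zero> \<in> A" "\<And>x y. \<lbrakk>x \<in> A; y \<in> A\<rbrakk> \<Longrightarrow> x \<oplus> y \<in> A"
    "\<And>d x. \<lbrakk>d \<in> D; x \<in> A\<rbrakk> \<Longrightarrow> d \<otimes> x \<in> A"
    using assms by (auto simp: D_subspace_def)
  fix x y assume xy: "x \<in> A" "y \<in> A"
  then have "(\<ominus> \<one>) \<otimes> y = \<ominus> y" using A(1) by (auto simp: l_minus)
  then show "x \<ominus> y \<in> A"
    using A(3)[OF xy(1) A(4)[of "\<ominus> \<one>" y]] xy by (simp add: a_minus_def)
qed

lemma D_subspace_span:
  assumes s: "range s \<subseteq> carrier R"
  shows "D_subspace (D_span s n)"
proof (induction n)
  case (Suc n)
  note S = D_subspaceD[OF Suc]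
  have sn: "s n \<in> carrier R" using s by auto
  show ?case
    unfolding D_subspace_def
  proof (intro conjI ballI)
    show "D_span s (Suc n) \<subseteq> carrier R" using S(1) sn by auto
    show "\<zero> \<in> D_span s (Suc n)" using S(2) sn by (auto intro!: image_eqI[of _ _ "(\<zero>, \<zero>)"])
  next
    fix x y assume "x \<in> D_span s (Suc n)" "y \<in> D_span s (Suc n)"
    then obtain v d v' d' where
      "v \<in> D_span s n" "d \<in> D" "x = v \<oplus> d \<otimes> s n" "v' \<in> D_span s n" "d' \<in> D" "y = v' \<oplus> d' \<otimes> s n"
      by auto
    moreover from this have "v \<in> carrier R" "v' \<in> carrier R" using S(1) by auto
    ultimately have "x \<oplus> y = (v \<oplus> v') \<oplus> (d \<oplus> d') \<otimes> s n"
      using sn \<open>d \<in> D\<close> \<open>d' \<in> D\<close> by (simp add: l_distr a_ac)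
    then show "x \<oplus> y \<in> D_span s (Suc n)"
      using S(3) \<open>v \<in> D_span s n\<close> \<open>v' \<in> D_span s n\<close> \<open>d \<in> D\<close> \<open>d' \<in> D\<close> by (auto intro!: image_eqI[of _ _ "(v \<oplus> v', d \<oplus> d')"])
  next
    fix x c assume "c \<in> D" "x \<in> D_span s (Suc n)"
    then obtain v d where "v \<in> D_span s n" "d \<in> D" "x = v \<oplus> d \<otimes> s n" by auto
    moreover from this \<open>c \<in> D\<close> have "c \<otimes> x = c \<otimes> v \<oplus> (c \<otimes> d) \<otimes> s n"
      using S(1) sn by (auto simp: r_distr m_assoc)
    ultimately show "c \<otimes> x \<in> D_span s (Suc n)"
      using S(4) \<open>c \<in> D\<close> by (auto intro!: image_eqI[of _ _ "(c \<otimes> v, c \<otimes> d)"])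
  qed
qed (auto simp: D_subspace_def)

lemma D_span_mono:
  assumes s: "range s \<subseteq> carrier R" and "m \<le> n"
  shows "D_span s m \<subseteq> D_span s n"
proof (rule lift_Suc_mono_le[of "D_span s", OF _ \<open>m \<le> n\<close>])
  fix n
  show "D_span s n \<subseteq> D_span s (Suc n)"
  proof
    fix v assume "v \<in> D_span s n"
    moreover have "s n \<in> carrier R" using s by auto
    ultimately show "v \<in> D_span s (Suc n)"
      using D_subspaceD(1)[OF D_subspace_span[OF s, of n]]
      by (auto intro!: image_eqI[of _ _ "(v, \<zero>)"])
  qed
qed

text \<open>
  As \<open>A\<close> misses the span of the first \<open>n\<close> generators, it meets the next span in a
  \<open>D\<close>-module of rank at most one, represented by \<open>r\<close>.
\<close>
lemma span_meet_step:
  assumes s: "range s \<subseteq> carrier R" and A: "D_subspace A" and VA: "D_span s n \<inter> A \<subseteq> {\<zero>}"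
  obtains r where "r \<in> carrier R" "r \<noteq> \<zero>"
    "\<And>B. \<lbrakk>D_subspace B; \<And>d. \<lbrakk>d \<in> D; d \<otimes> r \<in> B\<rbrakk> \<Longrightarrow> d = \<zero>\<rbrakk> \<Longrightarrow> D_span s (Suc n) \<inter> (A \<inter> B) \<subseteq> {\<zero>}"
proof (cases "D_span s (Suc n) \<inter> A \<subseteq> {\<zero>}")
  case True
  \<comment> \<open>Intersecting with \<open>B\<close> only shrinks the meet, so any nonzero
    \<open>r\<close> serves.\<close>
  then show ?thesis using that[of \<one>] by auto
next
  case False
  have sn: "s n \<in> carrier R" using s by auto
  note V = D_subspaceD[OF D_subspace_span[OF s, of n]] and A = D_subspaceD[OF A]
  from False obtain r where r: "r \<in> D_span s (Suc n)" "r \<in> A" "r \<noteq> \<zero>" by auto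
  then obtain v d where vd: "v \<in> D_span s n" "d \<in> D" "r = v \<oplus> d \<otimes> s n" by auto
  have carr: "v \<in> carrier R" "r \<in> carrier R" using vd V(1) r A(1) by auto
  have "d \<noteq> \<zero>"
  proof
    assume "d = \<zero>"
    then have "r = v" using vd carr sn by auto
    then show False using r vd VA by auto
  qed
  have "u = \<zero>"
    if B: "D_subspace B" "\<And>d. \<lbrakk>d \<in> D; d \<otimes> r \<in> B\<rbrakk> \<Longrightarrow> d = \<zero>"
      and u: "u \<in> D_span s (Suc n)" "u \<in> A" "u \<in> B" for B u
  proof -
    from u obtain v' d' where vd': "v' \<in> D_span s n" "d' \<in> D" "u = v' \<oplus> d' \<otimes> s n" by auto
    have carr': "v' \<in> carrier R" "u \<in> carrier R" using vd' V(1) u A(1) by auto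
    \<comment> \<open>Cross-multiplication by the leading coefficients \<open>d\<close> and
      \<open>d'\<close> cancels \<open>s n\<close>. The difference lies in \<open>A\<close> and in
      the span of the first \<open>n\<close> generators, so it vanishes and
      \<open>d' \<otimes> r = d \<otimes> u\<close> lies in \<open>B\<close>.\<close>
    have "d' \<otimes> r \<ominus> d \<otimes> u = d' \<otimes> v \<ominus> d \<otimes> v'"
    proof -
      have "d' \<otimes> r \<ominus> d \<otimes> u = (d' \<otimes> v \<oplus> d' \<otimes> d \<otimes> s n) \<ominus> (d \<otimes> v' \<oplus> d' \<otimes> d \<otimes> s n)"
        using vd vd' carr carr' sn by (simp add: r_distr m_ac)
      also have "\<dots> = d' \<otimes> v \<ominus> d \<otimes> v'"
        by (rule add_minus_add) (use vd(2) vd'(2) carr carr' sn in auto)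
      finally show ?thesis .
    qed
    moreover have "d' \<otimes> v \<ominus> d \<otimes> v' \<in> D_span s n"
      by (intro V(5) V(4) vd(1,2) vd'(1,2))
    moreover have "d' \<otimes> r \<ominus> d \<otimes> u \<in> A"
      by (intro A(5) A(4) r u vd(2) vd'(2))
    ultimately have "d' \<otimes> r \<ominus> d \<otimes> u = \<zero>" using VA by auto
    then have *: "d' \<otimes> r = d \<otimes> u" using vd(2) vd'(2) carr carr' by simp
    then have "d' \<otimes> r \<in> B" using D_subspaceD(4)[OF B(1)] u vd by auto
    then have "d' = \<zero>" using B(2) vd' by auto
    then have "d \<otimes> u = \<zero>" using * carr by auto
    then show "u = \<zero>" using \<open>d \<noteq> \<zero>\<close> integral vd carr' by blast
  qed
  then show ?thesis using that[of r] r carr by blast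
qed

text \<open>The finite products of elements of \<open>S\<close> form a countable monoid
  \<open>W\<close>. Its \<open>D\<close>-span \<open>T\<close> is a subring that contains
  \<open>D\<close> and \<open>S\<close>, hence all of \<open>R\<close>.\<close>

lemma spanning_sequence:
  assumes S: "S \<subseteq> carrier R" "countable S" and gen: "carrier R = generate_ring R (D \<union> S)"
  obtains s where "range s \<subseteq> carrier R" "carrier R = (\<Union>n. D_span s n)"
proof -
  define W where "W = (\<lambda>xs. foldr (\<otimes>) xs \<one>) ` lists S"
  have W1: "\<one> \<in> W" unfolding W_def by (rule image_eqI[of _ _ "[]"]) auto
  then have "W \<noteq> {}" by auto
  have "countable W" unfolding W_def by (intro countable_image countable_lists S)
  have fc: "foldr (\<otimes>) xs \<one> \<in> carrier R" if "xs \<in> lists S" for xs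
    using that S by (induction xs) auto
  have fapp: "foldr (\<otimes>) (xs @ ys) \<one> = foldr (\<otimes>) xs \<one> \<otimes> foldr (\<otimes>) ys \<one>"
    if "xs \<in> lists S" "ys \<in> lists S" for xs ys
    using that S fc by (induction xs) (auto simp: m_assoc subset_iff)
  have Wm: "x \<otimes> y \<in> W" if "x \<in> W" "y \<in> W" for x y
  proof -
    from that obtain xs ys where xy: "xs \<in> lists S" "ys \<in> lists S"
      "x = foldr (\<otimes>) xs \<one>" "y = foldr (\<otimes>) ys \<one>"
      by (auto simp: W_def)
    then have "x \<otimes> y = foldr (\<otimes>) (xs @ ys) \<one>" using fapp by simp
    then show ?thesis using xy(1,2) unfolding W_def by (intro image_eqI[of _ _ "xs @ ys"]) auto
  qed
  have SW: "x \<in> W" if "x \<in> S" for x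
    unfolding W_def by (rule image_eqI[of _ _ "[x]"]) (use that S in auto)
  define s where "s = from_nat_into W"
  have rs: "range s = W" unfolding s_def by (rule range_from_nat_into) fact+
  have s: "range s \<subseteq> carrier R" unfolding rs W_def using fc by auto
  define T where "T = (\<Union>n. D_span s n)"
  note V = D_subspaceD[OF D_subspace_span[OF s]]
  have TV: "\<exists>n. x \<in> D_span s n \<and> y \<in> D_span s n" if "x \<in> T" "y \<in> T" for x y
  proof -
    from that obtain m n where "x \<in> D_span s m" "y \<in> D_span s n" by (auto simp: T_def)
    then have "x \<in> D_span s (max m n)" "y \<in> D_span s (max m n)"
      using D_span_mono[OF s, of m "max m n"] D_span_mono[OF s, of n "max m n"] by auto
    then show ?thesis by blast
  qed
  have T_carr: "T \<subseteq> carrier R" using V(1) by (auto simp: T_def)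
  have T0: "\<zero> \<in> T" using V(2) by (auto simp: T_def)
  have Tadd: "x \<oplus> y \<in> T" if "x \<in> T" "y \<in> T" for x y
    using TV[OF that] V(3) by (auto simp: T_def)
  have TD: "d \<otimes> x \<in> T" if "d \<in> D" "x \<in> T" for d x
    using that V(4) by (auto simp: T_def)
  have TW: "w \<in> T" if w: "w \<in> W" for w
  proof -
    obtain n where "w = s n" using w rs by auto
    moreover have "s n \<in> carrier R" using s by auto
    ultimately have "w \<in> D_span s (Suc n)"
      using V(2)[of n] by (auto intro!: image_eqI[of _ _ "(\<zero>, \<one>)"])
    then show ?thesis unfolding T_def by blast
  qed
  \<comment> \<open>Multiplication by a fixed \<open>x\<close> need only be checked on the
    monomials, by induction along the spans.\<close>
  have mult_ext: "u \<otimes> x \<in> T" if P: "\<And>w. w \<in> W \<Longrightarrow> w \<otimes> x \<in> T" and x: "x \<in> carrier R" and u: "u \<in> T" for u x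
  proof -
    have "u \<otimes> x \<in> T" if "u \<in> D_span s n" for n
      using that
    proof (induction n arbitrary: u)
      case (Suc n)
      then obtain v d where vd: "v \<in> D_span s n" "d \<in> D" "u = v \<oplus> d \<otimes> s n" by auto
      have sn: "s n \<in> W" "s n \<in> carrier R" using rs s by auto
      moreover have "v \<in> carrier R" using vd(1) V(1) by auto
      ultimately have "u \<otimes> x = v \<otimes> x \<oplus> d \<otimes> (s n \<otimes> x)"
        using vd(2,3) x by (simp add: l_distr m_assoc)
      then show ?case using Suc.IH[OF vd(1)] P[OF sn(1)] TD[OF vd(2)] Tadd by auto
    qed (use x T0 in auto)
    then show ?thesis using u by (auto simp: T_def)
  qed
  \<comment> \<open>\<open>mult_ext\<close> is used twice: with a monomial \<open>w\<close> as right
    factor, where products of monomials are monomials again, and, after swapping factors, with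
    \<open>v\<close> as right factor.\<close>
  have Tmult: "u \<otimes> v \<in> T" if "u \<in> T" "v \<in> T" for u v
  proof (rule mult_ext)
    fix w assume w: "w \<in> W"
    then have wc: "w \<in> carrier R" using T_carr TW by auto
    have "v \<otimes> w \<in> T" using mult_ext[OF TW[OF Wm] wc \<open>v \<in> T\<close>] w by auto
    then show "w \<otimes> v \<in> T" using wc that T_carr m_comm by auto
  qed (use that T_carr in auto)
  have "x \<in> T" if "x \<in> generate_ring R (D \<union> S)" for x
    using that
  proof induction
    case (incl h)
    then consider "h \<in> D" | "h \<in> S" by auto
    then show ?case
    proof cases
      case 1 then show ?thesis using TD[OF 1 TW[OF W1]] by auto
    qed (use SW TW in auto)
  next
    case (a_inv h)
    then have "(\<ominus> \<one>) \<otimes> h = \<ominus> h" using T_carr by (auto simp: l_minus)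
    then show ?case using TD[of "\<ominus> \<one>" h] a_inv by simp
  qed (use TW W1 Tadd Tmult in auto)
  then have "carrier R = T" using gen T_carr by blast
  then show ?thesis using that[of s] s by (simp add: T_def)
qed

end

section \<open>Ascent of the countable meet property\<close>

context domain_extension
begin

lemma D_subspace_Inter:
  assumes "\<And>b. b \<in> B \<Longrightarrow> ideal b R"
  shows "D_subspace (carrier R \<inter> \<Inter>B)"
  unfolding D_subspace_def
  using assms ideal.I_l_closed[OF assms] additive_subgroup.a_closed[OF ideal.axioms(1)[OF assms]]
    additive_subgroup.zero_closed[OF ideal.axioms(1)[OF assms]] by auto

lemma D_domain: "domain (R\<lparr>carrier := D\<rparr>)"
  using subdomain_is_domain[OF subdomain] .

text \<open>Suppose that \<open>B\<close> has no common nonzero element. For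
  \<open>r \<noteq> \<zero>\<close>, the ideals of those \<open>d\<close> in \<open>D\<close> with
  \<open>d \<otimes> r\<close> in \<open>b\<close> then have zero meet, and by the property of
  \<open>D\<close> countably many of them do already. Together with \<open>span_meet_step\<close>
  this enlarges a countable subset of \<open>B\<close> so that its meet avoids one more span. The
  union over all steps is countable and has zero meet, as the spans exhaust
  \<open>R\<close>.\<close>

lemma countable_meets_suffice_extension:
  assumes cmD: "countable_meets_suffice (R\<lparr>carrier := D\<rparr>)"
    and s: "range s \<subseteq> carrier R" "carrier R = (\<Union>n. D_span s n)"
  shows "countable_meets_suffice R"
  unfolding countable_meets_suffice_def
proof (intro allI impI, elim conjE)
  fix B assume id: "\<forall>b\<in>B. ideal b R"
    and meet: "\<forall>C\<subseteq>B. countable C \<longrightarrow> (\<exists>a\<in>carrier R - {\<zero>}. \<forall>b\<in>C. a \<in> b)"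
  interpret D: domain "R\<lparr>carrier := D\<rparr>" by (rule D_domain)
  show "\<exists>a\<in>carrier R - {\<zero>}. \<forall>b\<in>B. a \<in> b"
  proof (rule ccontr)
    assume no: "\<not> ?thesis"
    have sep: "\<exists>C\<subseteq>B. countable C \<and> (\<forall>d\<in>D. (\<forall>b\<in>C. d \<otimes> r \<in> b) \<longrightarrow> d = \<zero>)"
      if r: "r \<in> carrier R" "r \<noteq> \<zero>" for r
    proof (rule ccontr)
      assume no': "\<not> ?thesis"
      have "ideal {d \<in> D. d \<otimes> r \<in> b} (R\<lparr>carrier := D\<rparr>)" if b: "b \<in> B" for b
      proof -
        interpret b: ideal b R using id b by auto
        show ?thesis
          by (rule D.idealI_cring) (use r in \<open>auto simp: l_distr m_assoc intro: b.I_l_closed\<close>)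
      qed
      then obtain d where d: "d \<in> D" "d \<noteq> \<zero>" "\<And>b. b \<in> B \<Longrightarrow> d \<otimes> r \<in> b"
      proof (rule countable_meets_sufficeD[OF cmD])
        fix C assume "C \<subseteq> B" "countable C"
        then obtain d where "d \<in> D" "\<forall>b\<in>C. d \<otimes> r \<in> b" "d \<noteq> \<zero>" using no' by blast
        then show "\<exists>a\<in>carrier (R\<lparr>carrier := D\<rparr>) - {\<zero>\<^bsub>R\<lparr>carrier := D\<rparr>\<^esub>}. \<forall>b\<in>C. a \<in> {d \<in> D. d \<otimes> r \<in> b}"
          by auto
      qed auto
      then show False using no r integral[of d r] by (auto intro!: bexI[of _ "d \<otimes> r"])
    qed
    define P where "P n C \<longleftrightarrow> C \<subseteq> B \<and> countable C \<and> D_span s n \<inter> (carrier R \<inter> \<Inter>C) \<subseteq> {\<zero>}" for n C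
    \<comment> \<open>The step relation is trivial: consecutive sets need not be compared, since
      their union is taken at the end.\<close>
    have "\<exists>C. \<forall>n. P n (C n) \<and> True"
    proof (rule dependent_nat_choice)
      show "\<exists>C. P 0 C" by (auto simp: P_def intro: exI[of _ "{}"])
    next
      fix C n assume "P n C"
      then have C: "C \<subseteq> B" "countable C" "D_span s n \<inter> (carrier R \<inter> \<Inter>C) \<subseteq> {\<zero>}"
        by (auto simp: P_def)
      have ideal_C: "ideal b R" if "b \<in> C" for b using that C id by auto
      obtain r where r: "r \<in> carrier R" "r \<noteq> \<zero>"
        "\<And>A. \<lbrakk>D_subspace A; \<And>d. \<lbrakk>d \<in> D; d \<otimes> r \<in> A\<rbrakk> \<Longrightarrow> d = \<zero>\<rbrakk> \<Longrightarrow>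
            D_span s (Suc n) \<inter> ((carrier R \<inter> \<Inter>C) \<inter> A) \<subseteq> {\<zero>}"
        using span_meet_step[OF s(1) D_subspace_Inter[OF ideal_C] C(3)] by metis
      obtain C' where C': "C' \<subseteq> B" "countable C'" "\<forall>d\<in>D. (\<forall>b\<in>C'. d \<otimes> r \<in> b) \<longrightarrow> d = \<zero>"
        using sep[OF r(1,2)] by blast
      have ideal_C': "ideal b R" if "b \<in> C'" for b using that C' id by auto
      have "D_span s (Suc n) \<inter> ((carrier R \<inter> \<Inter>C) \<inter> (carrier R \<inter> \<Inter>C')) \<subseteq> {\<zero>}"
        using C'(3) by (intro r(3) D_subspace_Inter ideal_C') auto
      then have "P (Suc n) (C \<union> C')" using C C' by (auto simp: P_def)
      then show "\<exists>C'. P (Suc n) C' \<and> True" by blast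
    qed
    then obtain C where C: "\<And>n. P n (C n)" by auto
    then have "(\<Union>n. C n) \<subseteq> B" "countable (\<Union>n. C n)" by (auto simp: P_def)
    then obtain a where a: "a \<in> carrier R - {\<zero>}" "\<forall>b\<in>(\<Union>n. C n). a \<in> b" using meet by meson
    then obtain n where "a \<in> D_span s n" using s(2) by auto
    then have "a \<in> D_span s n \<inter> (carrier R \<inter> \<Inter>(C n))" using a by auto
    then show False using C[of n] a(1) unfolding P_def by blast
  qed
qed

end

subsection \<open>Sequences of modules with torsion product\<close>

text \<open>A diagonal argument. It lets one scalar sequence test countably many others at
  once.\<close>

lemma common_slower_sequence:
  fixes k :: "nat \<Rightarrow> nat \<Rightarrow> nat"
  assumes k: "\<And>j. filterlim (k j) at_top sequentially"
  obtains h :: "nat \<Rightarrow> nat" where "filterlim h at_top sequentially" "\<And>j. \<forall>\<^sub>F i in sequentially. h i \<le> k j i"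
proof -
  \<comment> \<open>The clause \<open>n \<le> i\<close> makes a greatest \<open>n\<close> exist.
    Only the first \<open>n\<close> sequences are compared at level \<open>n\<close>, so
    \<open>h i \<le> k j i\<close> is guaranteed once \<open>h i > j\<close>.\<close>
  define P where "P i n \<longleftrightarrow> n \<le> i \<and> (\<forall>j<n. n \<le> k j i)" for i n
  define h where "h i = (GREATEST n. P i n)" for i
  have h: "P i (h i)" for i
    unfolding h_def by (rule GreatestI_nat[of "P i" 0 i]) (auto simp: P_def)
  have "\<forall>\<^sub>F i in sequentially. N \<le> h i" for N
  proof -
    have "\<forall>\<^sub>F i in sequentially. N \<le> i \<and> (\<forall>j\<in>{..<N}. N \<le> k j i)"
      using k by (intro eventually_conj eventually_ge_at_top eventually_ball_finite ballI)
        (auto simp: filterlim_at_top)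
    then show ?thesis
    proof eventually_elim
      case (elim i)
      then show ?case
        unfolding h_def by (intro Greatest_le_nat[of "P i" N i]) (auto simp: P_def)
    qed
  qed
  then have lim: "filterlim h at_top sequentially" by (auto simp: filterlim_at_top)
  have "\<forall>\<^sub>F i in sequentially. h i \<le> k j i" for j
    using eventually_compose_filterlim[OF eventually_gt_at_top[of j] lim]
  proof eventually_elim
    case (elim i)
    then show ?case using h[of i] by (auto simp: P_def)
  qed
  with lim show ?thesis using that by blast
qed

text \<open>Choose a strictly increasing \<open>f\<close> with \<open>P n (f n)\<close> for all
  \<open>n\<close>; then \<open>k\<close> is a generalized inverse of \<open>f\<close>, with
  \<open>k (f n) = n\<close>.\<close>

lemma frequently_along_diverging_sequence:
  fixes P :: "nat \<Rightarrow> nat \<Rightarrow> bool"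
  assumes P: "\<And>n. \<exists>\<^sub>F i in sequentially. P n i"
  obtains k where "filterlim k at_top sequentially" "\<exists>\<^sub>F i in sequentially. P (k i) i"
proof -
  have "\<exists>f. \<forall>n. P n (f n) \<and> f n < f (Suc n)"
  proof (rule dependent_nat_choice)
    show "\<exists>i. P 0 i" using P[of 0] by (auto simp: frequently_sequentially)
    show "\<exists>j. P (Suc n) j \<and> i < j" for i n
      using P[of "Suc n"] unfolding frequently_sequentially by (meson Suc_le_lessD)
  qed
  then obtain f where f: "\<And>n. P n (f n)" "strict_mono f" by (auto simp: strict_mono_Suc_iff)
  note le_f = strict_mono_imp_increasing[OF f(2)]
  \<comment> \<open>For \<open>i < f 0\<close> no \<open>n\<close> qualifies and the value is
    arbitrary, which does not affect the limit.\<close>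
  define k where "k i = (GREATEST n. f n \<le> i)" for i
  have "N \<le> k i" if "f N \<le> i" for N i
    unfolding k_def using that le_f by (intro Greatest_le_nat[of _ N i]) (auto intro: order_trans)
  then have "filterlim k at_top sequentially"
    unfolding filterlim_at_top eventually_sequentially by blast
  moreover have "k (f n) = n" for n
    unfolding k_def using f(2) by (intro Greatest_equality) (auto simp: strict_mono_less_eq)
  then have "\<exists>\<^sub>F i in sequentially. P (k i) i"
    unfolding frequently_sequentially using f(1) le_f by metis
  ultimately show ?thesis using that by blast
qed

section \<open>Unbounded sequences of submodules and their splitting\<close>

locale torsion_sequence = domain R for R (structure) +
  fixes M :: "nat \<Rightarrow> ('a, 'm) module"
  assumes M: "\<And>n. module R (M n)"
    and torsion: "\<And>x. (\<And>n. x n \<in> carrier (M n)) \<Longrightarrow>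
      \<exists>r\<in>carrier R - {\<zero>}. \<forall>n. r \<odot>\<^bsub>M n\<^esub> x n = \<zero>\<^bsub>M n\<^esub>"
    and meets: "countable_meets_suffice R"
begin

lemma smult_carrier [simp, intro]: "\<lbrakk>a \<in> carrier R; x \<in> carrier (M n)\<rbrakk> \<Longrightarrow> a \<odot>\<^bsub>M n\<^esub> x \<in> carrier (M n)"
  and smult_zero [simp]: "a \<in> carrier R \<Longrightarrow> a \<odot>\<^bsub>M n\<^esub> \<zero>\<^bsub>M n\<^esub> = \<zero>\<^bsub>M n\<^esub>"
  and zero_smult [simp]: "x \<in> carrier (M n) \<Longrightarrow> \<zero> \<odot>\<^bsub>M n\<^esub> x = \<zero>\<^bsub>M n\<^esub>"
  and one_smult [simp]: "x \<in> carrier (M n) \<Longrightarrow> \<one> \<odot>\<^bsub>M n\<^esub> x = x"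
  and smult_add: "\<lbrakk>a \<in> carrier R; x \<in> carrier (M n); y \<in> carrier (M n)\<rbrakk> \<Longrightarrow>
    a \<odot>\<^bsub>M n\<^esub> (x \<oplus>\<^bsub>M n\<^esub> y) = a \<odot>\<^bsub>M n\<^esub> x \<oplus>\<^bsub>M n\<^esub> a \<odot>\<^bsub>M n\<^esub> y"
  and add_smult: "\<lbrakk>a \<in> carrier R; b \<in> carrier R; x \<in> carrier (M n)\<rbrakk> \<Longrightarrow>
    (a \<oplus> b) \<odot>\<^bsub>M n\<^esub> x = a \<odot>\<^bsub>M n\<^esub> x \<oplus>\<^bsub>M n\<^esub> b \<odot>\<^bsub>M n\<^esub> x"
  and mult_smult: "\<lbrakk>a \<in> carrier R; b \<in> carrier R; x \<in> carrier (M n)\<rbrakk> \<Longrightarrow>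
    (a \<otimes> b) \<odot>\<^bsub>M n\<^esub> x = a \<odot>\<^bsub>M n\<^esub> (b \<odot>\<^bsub>M n\<^esub> x)"
  and zero_M [simp]: "\<zero>\<^bsub>M n\<^esub> \<in> carrier (M n)"
  and add_M [simp, intro]: "\<lbrakk>x \<in> carrier (M n); y \<in> carrier (M n)\<rbrakk> \<Longrightarrow> x \<oplus>\<^bsub>M n\<^esub> y \<in> carrier (M n)"
  and zero_add_M [simp]: "x \<in> carrier (M n) \<Longrightarrow> \<zero>\<^bsub>M n\<^esub> \<oplus>\<^bsub>M n\<^esub> x = x"
  and add_zero_M [simp]: "x \<in> carrier (M n) \<Longrightarrow> x \<oplus>\<^bsub>M n\<^esub> \<zero>\<^bsub>M n\<^esub> = x"
proof -
  interpret module R "M n" by (rule M)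
  show "\<lbrakk>a \<in> carrier R; x \<in> carrier (M n)\<rbrakk> \<Longrightarrow> a \<odot>\<^bsub>M n\<^esub> x \<in> carrier (M n)"
    "a \<in> carrier R \<Longrightarrow> a \<odot>\<^bsub>M n\<^esub> \<zero>\<^bsub>M n\<^esub> = \<zero>\<^bsub>M n\<^esub>"
    "x \<in> carrier (M n) \<Longrightarrow> \<zero> \<odot>\<^bsub>M n\<^esub> x = \<zero>\<^bsub>M n\<^esub>"
    "x \<in> carrier (M n) \<Longrightarrow> \<one> \<odot>\<^bsub>M n\<^esub> x = x"
    "\<lbrakk>a \<in> carrier R; x \<in> carrier (M n); y \<in> carrier (M n)\<rbrakk> \<Longrightarrow>
      a \<odot>\<^bsub>M n\<^esub> (x \<oplus>\<^bsub>M n\<^esub> y) = a \<odot>\<^bsub>M n\<^esub> x \<oplus>\<^bsub>M n\<^esub> a \<odot>\<^bsub>M n\<^esub> y"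
    "\<lbrakk>a \<in> carrier R; b \<in> carrier R; x \<in> carrier (M n)\<rbrakk> \<Longrightarrow>
      (a \<oplus> b) \<odot>\<^bsub>M n\<^esub> x = a \<odot>\<^bsub>M n\<^esub> x \<oplus>\<^bsub>M n\<^esub> b \<odot>\<^bsub>M n\<^esub> x"
    "\<lbrakk>a \<in> carrier R; b \<in> carrier R; x \<in> carrier (M n)\<rbrakk> \<Longrightarrow>
      (a \<otimes> b) \<odot>\<^bsub>M n\<^esub> x = a \<odot>\<^bsub>M n\<^esub> (b \<odot>\<^bsub>M n\<^esub> x)"
    "\<zero>\<^bsub>M n\<^esub> \<in> carrier (M n)"
    "\<lbrakk>x \<in> carrier (M n); y \<in> carrier (M n)\<rbrakk> \<Longrightarrow> x \<oplus>\<^bsub>M n\<^esub> y \<in> carrier (M n)"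
    "x \<in> carrier (M n) \<Longrightarrow> \<zero>\<^bsub>M n\<^esub> \<oplus>\<^bsub>M n\<^esub> x = x"
    "x \<in> carrier (M n) \<Longrightarrow> x \<oplus>\<^bsub>M n\<^esub> \<zero>\<^bsub>M n\<^esub> = x"
    by (auto simp: smult_l_distr smult_r_distr smult_assoc1)
qed

lemma smult_commute:
  "\<lbrakk>a \<in> carrier R; b \<in> carrier R; x \<in> carrier (M n)\<rbrakk> \<Longrightarrow>
    a \<odot>\<^bsub>M n\<^esub> (b \<odot>\<^bsub>M n\<^esub> x) = b \<odot>\<^bsub>M n\<^esub> (a \<odot>\<^bsub>M n\<^esub> x)"
  using mult_smult[of a b x n] mult_smult[of b a x n] m_comm[of a b] by simp

text \<open>For the full carriers this is the negation of the conclusion of productive boundedness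
  over the index set of naturals.\<close>

definition unbounded :: "(nat \<Rightarrow> 'm set) \<Rightarrow> bool" where
  "unbounded L \<longleftrightarrow> (\<forall>r\<in>carrier R - {\<zero>}. \<exists>\<^sub>F n in sequentially. \<exists>x\<in>L n. r \<odot>\<^bsub>M n\<^esub> x \<noteq> \<zero>\<^bsub>M n\<^esub>)"

definition scaled :: "(nat \<Rightarrow> 'a) \<Rightarrow> (nat \<Rightarrow> 'm set) \<Rightarrow> nat \<Rightarrow> 'm set" where
  "scaled e L n = (\<lambda>x. e n \<odot>\<^bsub>M n\<^esub> x) ` L n"

definition annihilated :: "(nat \<Rightarrow> 'a) \<Rightarrow> (nat \<Rightarrow> 'm set) \<Rightarrow> nat \<Rightarrow> 'm set" where
  "annihilated e L n = {x \<in> L n. e n \<odot>\<^bsub>M n\<^esub> x = \<zero>\<^bsub>M n\<^esub>}"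

lemma not_unboundedE:
  assumes "\<not> unbounded L"
  obtains r where "r \<in> carrier R" "r \<noteq> \<zero>" "\<forall>\<^sub>F n in sequentially. \<forall>x\<in>L n. r \<odot>\<^bsub>M n\<^esub> x = \<zero>\<^bsub>M n\<^esub>"
  using assms by (auto simp: unbounded_def not_frequently)

text \<open>Supplies the ideals to which the compactness assumption \<open>meets\<close> is
  applied.\<close>

lemma eventual_annihilator_ideal:
  assumes "\<And>n. Y n \<subseteq> carrier (M n)"
  shows "ideal {r \<in> carrier R. \<forall>\<^sub>F n in sequentially. \<forall>x\<in>Y n. r \<odot>\<^bsub>M n\<^esub> x = \<zero>\<^bsub>M n\<^esub>} R"
proof (rule idealI_cring)
  fix a b assume "a \<in> {r \<in> carrier R. \<forall>\<^sub>F n in sequentially. \<forall>x\<in>Y n. r \<odot>\<^bsub>M n\<^esub> x = \<zero>\<^bsub>M n\<^esub>}"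
    "b \<in> {r \<in> carrier R. \<forall>\<^sub>F n in sequentially. \<forall>x\<in>Y n. r \<odot>\<^bsub>M n\<^esub> x = \<zero>\<^bsub>M n\<^esub>}"
  then have ab: "a \<in> carrier R" "b \<in> carrier R"
    and ev: "\<forall>\<^sub>F n in sequentially. \<forall>x\<in>Y n. a \<odot>\<^bsub>M n\<^esub> x = \<zero>\<^bsub>M n\<^esub>"
      "\<forall>\<^sub>F n in sequentially. \<forall>x\<in>Y n. b \<odot>\<^bsub>M n\<^esub> x = \<zero>\<^bsub>M n\<^esub>" by auto
  from ev have "\<forall>\<^sub>F n in sequentially. \<forall>x\<in>Y n. (a \<oplus> b) \<odot>\<^bsub>M n\<^esub> x = \<zero>\<^bsub>M n\<^esub>"
  proof eventually_elim
    case (elim n)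
    show ?case
    proof
      fix x assume "x \<in> Y n"
      moreover from this have "x \<in> carrier (M n)" using assms by auto
      ultimately show "(a \<oplus> b) \<odot>\<^bsub>M n\<^esub> x = \<zero>\<^bsub>M n\<^esub>" using elim ab add_smult[of a b x n] by simp
    qed
  qed
  then show "a \<oplus> b \<in> {r \<in> carrier R. \<forall>\<^sub>F n in sequentially. \<forall>x\<in>Y n. r \<odot>\<^bsub>M n\<^esub> x = \<zero>\<^bsub>M n\<^esub>}"
    using ab by simp
next
  fix c a assume c: "c \<in> carrier R"
    and "a \<in> {r \<in> carrier R. \<forall>\<^sub>F n in sequentially. \<forall>x\<in>Y n. r \<odot>\<^bsub>M n\<^esub> x = \<zero>\<^bsub>M n\<^esub>}"
  then have a: "a \<in> carrier R"
    and ev: "\<forall>\<^sub>F n in sequentially. \<forall>x\<in>Y n. a \<odot>\<^bsub>M n\<^esub> x = \<zero>\<^bsub>M n\<^esub>" by auto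
  from ev have "\<forall>\<^sub>F n in sequentially. \<forall>x\<in>Y n. (c \<otimes> a) \<odot>\<^bsub>M n\<^esub> x = \<zero>\<^bsub>M n\<^esub>"
  proof eventually_elim
    case (elim n)
    show ?case
    proof
      fix x assume "x \<in> Y n"
      moreover from this have "x \<in> carrier (M n)" using assms by auto
      ultimately show "(c \<otimes> a) \<odot>\<^bsub>M n\<^esub> x = \<zero>\<^bsub>M n\<^esub>" using elim c a mult_smult[of c a x n] by simp
    qed
  qed
  then show "c \<otimes> a \<in> {r \<in> carrier R. \<forall>\<^sub>F n in sequentially. \<forall>x\<in>Y n. r \<odot>\<^bsub>M n\<^esub> x = \<zero>\<^bsub>M n\<^esub>}"
    using c a by simp
next
  have "\<forall>x\<in>Y n. \<zero> \<odot>\<^bsub>M n\<^esub> x = \<zero>\<^bsub>M n\<^esub>" for n using assms[of n] by auto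
  then show "\<zero> \<in> {r \<in> carrier R. \<forall>\<^sub>F n in sequentially. \<forall>x\<in>Y n. r \<odot>\<^bsub>M n\<^esub> x = \<zero>\<^bsub>M n\<^esub>}" by simp
qed auto

text \<open>If scaling along every diverging \<open>k\<close> destroyed unboundedness, every ideal
  \<open>b k\<close> of eventual annihilators would be nonzero. Slower sequences have smaller
  ideals, so countably many of them share a nonzero element, and compactness gives one
  \<open>r\<close> in all of them. Then \<open>r\<close> eventually kills \<open>d n L\<close> for
  some fixed \<open>n\<close>, so \<open>r \<otimes> d n\<close> eventually kills
  \<open>L\<close>.\<close>

lemma unbounded_scaled_slowly:
  assumes L: "\<And>n. L n \<subseteq> carrier (M n)" "unbounded L"
    and d: "\<And>n. d n \<in> carrier R" "\<And>n. d n \<noteq> \<zero>" "\<And>n. \<exists>c\<in>carrier R. d (Suc n) = c \<otimes> d n"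
  obtains k where "filterlim k at_top sequentially" "unbounded (scaled (\<lambda>i. d (k i)) L)"
proof (rule ccontr)
  note witness = that
  assume no: "\<not> thesis"
  define K where "K = {k :: nat \<Rightarrow> nat. filterlim k at_top sequentially}"
  define b where "b k = {r \<in> carrier R. \<forall>\<^sub>F i in sequentially. \<forall>x\<in>scaled (\<lambda>i. d (k i)) L i. r \<odot>\<^bsub>M i\<^esub> x = \<zero>\<^bsub>M i\<^esub>}" for k
  have Lc: "x \<in> carrier (M i)" if "x \<in> L i" for x i using that L by auto
  have dvd: "\<exists>c\<in>carrier R. d n = c \<otimes> d m" if "m \<le> n" for m n
    using that
  proof (induction rule: dec_induct)
    case base
    then show ?case using d(1)[of m] by (intro bexI[of _ \<one>]) auto
  next
    case (step n)
    then obtain c c' where "c \<in> carrier R" "d n = c \<otimes> d m" "c' \<in> carrier R" "d (Suc n) = c' \<otimes> d n"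
      using d(3)[of n] by auto
    then show ?case using d(1)[of m] by (intro bexI[of _ "c' \<otimes> c"]) (auto simp: m_assoc)
  qed
  have vanish: "r \<odot>\<^bsub>M i\<^esub> (d n \<odot>\<^bsub>M i\<^esub> x) = \<zero>\<^bsub>M i\<^esub>"
    if rx: "r \<odot>\<^bsub>M i\<^esub> (d m \<odot>\<^bsub>M i\<^esub> x) = \<zero>\<^bsub>M i\<^esub>" "m \<le> n" "r \<in> carrier R" "x \<in> L i" for r i m n x
  proof -
    obtain c where c: "c \<in> carrier R" "d n = c \<otimes> d m" using dvd \<open>m \<le> n\<close> by blast
    have x: "x \<in> carrier (M i)" using Lc rx by auto
    have "r \<odot>\<^bsub>M i\<^esub> (d n \<odot>\<^bsub>M i\<^esub> x) = c \<odot>\<^bsub>M i\<^esub> (r \<odot>\<^bsub>M i\<^esub> (d m \<odot>\<^bsub>M i\<^esub> x))"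
      using c x d(1)[of m] rx(3) by (simp add: mult_smult smult_commute[of r c])
    then show ?thesis using rx c by simp
  qed
  \<comment> \<open>A single diverging \<open>h\<close> below all sequences in \<open>C\<close> is
    enough: what kills \<open>d (h i) \<odot> x\<close> also kills \<open>d (k i) \<odot> x\<close>
    as soon as \<open>h i \<le> k i\<close>, by divisibility.\<close>
  have nz: "\<exists>a\<in>carrier R - {\<zero>}. \<forall>k\<in>C. a \<in> b k" if C: "C \<subseteq> K" "countable C" for C
  proof (cases "C = {}")
    case True
    then show ?thesis using one_closed one_not_zero by blast
  next
    case False
    define kk where "kk = from_nat_into C"
    have kk: "range kk = C" unfolding kk_def by (rule range_from_nat_into) fact+
    then have "filterlim (kk j) at_top sequentially" for j using C by (auto simp: K_def)
    then obtain h where h: "filterlim h at_top sequentially" "\<And>j. \<forall>\<^sub>F i in sequentially. h i \<le> kk j i"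
      using common_slower_sequence[of kk] by metis
    from h(1) no witness have "\<not> unbounded (scaled (\<lambda>i. d (h i)) L)" by auto
    then obtain r where r: "r \<in> carrier R" "r \<noteq> \<zero>"
      "\<forall>\<^sub>F i in sequentially. \<forall>x\<in>scaled (\<lambda>i. d (h i)) L i. r \<odot>\<^bsub>M i\<^esub> x = \<zero>\<^bsub>M i\<^esub>"
      by (rule not_unboundedE)
    have "r \<in> b (kk j)" for j
    proof -
      have "\<forall>\<^sub>F i in sequentially. \<forall>x\<in>scaled (\<lambda>i. d (kk j i)) L i. r \<odot>\<^bsub>M i\<^esub> x = \<zero>\<^bsub>M i\<^esub>"
        using h(2)[of j] r(3)
        by eventually_elim (use vanish r(1) in \<open>auto simp: scaled_def\<close>)
      then show ?thesis using r(1) by (simp add: b_def)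
    qed
    then show ?thesis using r(1,2) kk by blast
  qed
  have "ideal (b k) R" for k
    unfolding b_def by (rule eventual_annihilator_ideal) (use Lc d(1) in \<open>auto simp: scaled_def\<close>)
  then obtain r where r: "r \<in> carrier R" "r \<noteq> \<zero>" "\<And>k. k \<in> K \<Longrightarrow> r \<in> b k"
    using countable_meets_sufficeD[OF meets, of K b] nz by metis
  \<comment> \<open>If every \<open>n\<close> failed infinitely often, the failures could be
    collected along one diverging \<open>k\<close>, against \<open>r \<in> b k\<close>.\<close>
  have "\<exists>n. \<forall>\<^sub>F i in sequentially. \<forall>x\<in>L i. r \<odot>\<^bsub>M i\<^esub> (d n \<odot>\<^bsub>M i\<^esub> x) = \<zero>\<^bsub>M i\<^esub>"
  proof (rule ccontr)
    assume "\<not> ?thesis"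
    then have "\<exists>\<^sub>F i in sequentially. \<not> (\<forall>x\<in>L i. r \<odot>\<^bsub>M i\<^esub> (d n \<odot>\<^bsub>M i\<^esub> x) = \<zero>\<^bsub>M i\<^esub>)" for n
      by (simp add: not_eventually)
    then obtain k where k: "filterlim k at_top sequentially"
      "\<exists>\<^sub>F i in sequentially. \<not> (\<forall>x\<in>L i. r \<odot>\<^bsub>M i\<^esub> (d (k i) \<odot>\<^bsub>M i\<^esub> x) = \<zero>\<^bsub>M i\<^esub>)"
      by (rule frequently_along_diverging_sequence)
    then have "r \<in> b k" using r(3) by (simp add: K_def)
    then show False using k(2) by (simp add: b_def scaled_def frequently_def)
  qed
  then obtain n where n: "\<forall>\<^sub>F i in sequentially. \<forall>x\<in>L i. r \<odot>\<^bsub>M i\<^esub> (d n \<odot>\<^bsub>M i\<^esub> x) = \<zero>\<^bsub>M i\<^esub>" by auto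
  have "r \<otimes> d n \<in> carrier R - {\<zero>}" using r d(1,2)[of n] integral[of r "d n"] by auto
  then have "\<exists>\<^sub>F i in sequentially. \<exists>x\<in>L i. (r \<otimes> d n) \<odot>\<^bsub>M i\<^esub> x \<noteq> \<zero>\<^bsub>M i\<^esub>"
    using L(2) by (simp add: unbounded_def)
  moreover have "(r \<otimes> d n) \<odot>\<^bsub>M i\<^esub> x = r \<odot>\<^bsub>M i\<^esub> (d n \<odot>\<^bsub>M i\<^esub> x)" if "x \<in> L i" for x i
    using mult_smult r(1) d(1) Lc[OF that] by simp
  ultimately have "\<exists>\<^sub>F i in sequentially. \<not> (\<forall>x\<in>L i. r \<odot>\<^bsub>M i\<^esub> (d n \<odot>\<^bsub>M i\<^esub> x) = \<zero>\<^bsub>M i\<^esub>)"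
    by simp
  then show False using n by (simp add: frequently_def)
qed

text \<open>
  Otherwise, for each \<open>r \<noteq> \<zero>\<close>, the \<open>r\<close>-torsion of \<open>L\<close> is eventually killed by some nonzero
  scalar; compactness makes that scalar independent of \<open>r\<close>, and then it kills all of \<open>L\<close>, because
  the product is torsion.
\<close>
lemma unbounded_splitting:
  assumes L: "\<And>n. L n \<subseteq> carrier (M n)" "unbounded L"
  obtains e where "\<And>n. e n \<in> carrier R" "unbounded (scaled e L)" "unbounded (annihilated e L)"
proof (rule ccontr)
  note witness = that
  assume no: "\<not> thesis"
  have Lc: "x \<in> carrier (M i)" if "x \<in> L i" for x i using that L by auto
  define c where "c r = {s \<in> carrier R. \<forall>\<^sub>F i in sequentially. \<forall>x\<in>annihilated (\<lambda>_. r) L i. s \<odot>\<^bsub>M i\<^esub> x = \<zero>\<^bsub>M i\<^esub>}" for r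
  have nz: "\<exists>a\<in>carrier R - {\<zero>}. \<forall>r\<in>C. a \<in> c r" if C: "C \<subseteq> carrier R - {\<zero>}" "countable C" for C
  proof (cases "C = {}")
    case True
    then show ?thesis using one_closed one_not_zero by blast
  next
    case False
    define rr where "rr = from_nat_into C"
    have rr: "range rr = C" unfolding rr_def by (rule range_from_nat_into) fact+
    then have rr': "rr j \<in> carrier R" "rr j \<noteq> \<zero>" for j using C by auto
    \<comment> \<open>\<open>d n\<close> is the product of the first \<open>n\<close> terms of the
      enumeration of \<open>C\<close>, so every \<open>rr j\<close> divides \<open>d n\<close> for
      all \<open>n > j\<close>.\<close>
    define d where "d = rec_nat \<one> (\<lambda>n x. rr n \<otimes> x)"
    have d_simps: "d 0 = \<one>" "d (Suc n) = rr n \<otimes> d n" for n by (auto simp: d_def)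
    have d: "d n \<in> carrier R - {\<zero>}" for n
      by (induction n) (use rr' integral in \<open>auto simp: d_simps\<close>)
    have dvd: "\<exists>u\<in>carrier R. d n = u \<otimes> rr j" if "Suc j \<le> n" for j n
      using that
    proof (induction rule: dec_induct)
      case base
      then show ?case using d[of j] rr' m_comm by (intro bexI[of _ "d j"]) (auto simp: d_simps)
    next
      case (step n)
      then obtain u where "u \<in> carrier R" "d n = u \<otimes> rr j" by auto
      then show ?case using rr' by (intro bexI[of _ "rr n \<otimes> u"]) (auto simp: d_simps m_assoc)
    qed
    obtain k where k: "filterlim k at_top sequentially" "unbounded (scaled (\<lambda>i. d (k i)) L)"
      by (rule unbounded_scaled_slowly[OF L, of d]) (use d rr' d_simps in auto)
    \<comment> \<open>As \<open>scaled\<close> is unbounded for the scalars \<open>d (k i)\<close>,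
      the assumption forces their \<open>annihilated\<close> part to be bounded. That part
      eventually contains the \<open>rr j\<close>-torsion of \<open>L\<close> for every
      \<open>j\<close>.\<close>
    then have "\<not> unbounded (annihilated (\<lambda>i. d (k i)) L)" using no witness[of "\<lambda>i. d (k i)"] d by blast
    then obtain s where s: "s \<in> carrier R" "s \<noteq> \<zero>"
      "\<forall>\<^sub>F i in sequentially. \<forall>x\<in>annihilated (\<lambda>i. d (k i)) L i. s \<odot>\<^bsub>M i\<^esub> x = \<zero>\<^bsub>M i\<^esub>"
      by (rule not_unboundedE)
    have "s \<in> c (rr j)" for j
    proof -
      have "\<forall>\<^sub>F i in sequentially. Suc j \<le> k i" using k(1) by (auto simp: filterlim_at_top)
      then have "\<forall>\<^sub>F i in sequentially. \<forall>x\<in>annihilated (\<lambda>_. rr j) L i. s \<odot>\<^bsub>M i\<^esub> x = \<zero>\<^bsub>M i\<^esub>"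
        using s(3)
      proof eventually_elim
        case (elim i)
        then obtain u where u: "u \<in> carrier R" "d (k i) = u \<otimes> rr j" using dvd by blast
        have "annihilated (\<lambda>_. rr j) L i \<subseteq> annihilated (\<lambda>i. d (k i)) L i"
          using u rr' Lc by (auto simp: annihilated_def mult_smult)
        then show ?case using elim(2) by blast
      qed
      then show ?thesis using s(1) by (simp add: c_def)
    qed
    then show ?thesis using s(1,2) rr by blast
  qed
  have "ideal (c r) R" for r
    unfolding c_def by (rule eventual_annihilator_ideal) (use Lc in \<open>auto simp: annihilated_def\<close>)
  then obtain s where s: "s \<in> carrier R" "s \<noteq> \<zero>" "\<And>r. r \<in> carrier R - {\<zero>} \<Longrightarrow> s \<in> c r"
    using countable_meets_sufficeD[OF meets, of "carrier R - {\<zero>}" c] nz by metis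
  \<comment> \<open>In each coordinate, an element of \<open>L i\<close> that \<open>s\<close> does
    not kill, if there is one, and otherwise zero. Some \<open>r\<close> kills all
    \<open>x i\<close>, so they lie in the \<open>r\<close>-torsion of \<open>L\<close> wherever
    they are witnesses, and \<open>s\<close> must eventually kill them there.\<close>
  define x where "x i = (if \<exists>x\<in>L i. s \<odot>\<^bsub>M i\<^esub> x \<noteq> \<zero>\<^bsub>M i\<^esub> then SOME x. x \<in> L i \<and> s \<odot>\<^bsub>M i\<^esub> x \<noteq> \<zero>\<^bsub>M i\<^esub>
    else \<zero>\<^bsub>M i\<^esub>)" for i
  have x: "x i \<in> L i \<and> s \<odot>\<^bsub>M i\<^esub> x i \<noteq> \<zero>\<^bsub>M i\<^esub>" if "\<exists>x\<in>L i. s \<odot>\<^bsub>M i\<^esub> x \<noteq> \<zero>\<^bsub>M i\<^esub>" for i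
  proof -
    from that have "\<exists>x. x \<in> L i \<and> s \<odot>\<^bsub>M i\<^esub> x \<noteq> \<zero>\<^bsub>M i\<^esub>" by blast
    from someI_ex[OF this] show ?thesis using that by (simp add: x_def)
  qed
  have "x i \<in> carrier (M i)" for i
  proof (cases "\<exists>x\<in>L i. s \<odot>\<^bsub>M i\<^esub> x \<noteq> \<zero>\<^bsub>M i\<^esub>")
    case True
    then show ?thesis using x Lc by blast
  qed (auto simp: x_def)
  then obtain r where r: "r \<in> carrier R - {\<zero>}" "\<And>i. r \<odot>\<^bsub>M i\<^esub> x i = \<zero>\<^bsub>M i\<^esub>"
    using torsion[of x] by auto
  have "\<exists>\<^sub>F i in sequentially. \<exists>x\<in>L i. s \<odot>\<^bsub>M i\<^esub> x \<noteq> \<zero>\<^bsub>M i\<^esub>"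
    using L(2) s(1,2) by (simp add: unbounded_def)
  moreover have "\<forall>\<^sub>F i in sequentially. \<forall>x\<in>annihilated (\<lambda>_. r) L i. s \<odot>\<^bsub>M i\<^esub> x = \<zero>\<^bsub>M i\<^esub>"
    using s(3)[OF r(1)] by (simp add: c_def)
  ultimately have "\<exists>\<^sub>F i in sequentially. False"
  proof (rule frequently_rev_mp[OF _ eventually_mono])
    fix i assume *: "\<forall>x\<in>annihilated (\<lambda>_. r) L i. s \<odot>\<^bsub>M i\<^esub> x = \<zero>\<^bsub>M i\<^esub>"
    show "(\<exists>x\<in>L i. s \<odot>\<^bsub>M i\<^esub> x \<noteq> \<zero>\<^bsub>M i\<^esub>) \<longrightarrow> False"
      using x[of i] r(2)[of i] * by (auto simp: annihilated_def)
  qed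
  then show False by simp
qed

end

section \<open>Restriction of scalars to D and construction of a non-torsion element\<close>

lemma module_restrict_scalars:
  assumes "module R M" "subdomain D R"
  shows "module (R\<lparr>carrier := D\<rparr>) M"
proof -
  interpret module R M by fact
  have "D \<subseteq> carrier R" by (rule subdomainE(1)[OF assms(2)])
  then show ?thesis
    by (intro moduleI M.abelian_group_axioms)
      (use R.subcring_iff subdomain.axioms(1)[OF assms(2)] in
        \<open>auto simp: smult_l_distr smult_r_distr smult_assoc1 subset_iff\<close>)
qed

locale torsion_sequence_extension = torsion_sequence R M + domain_extension R D
  for R (structure) and M :: "nat \<Rightarrow> ('a, 'm) module" and D +
  assumes bounded_D: "productively_bounded TYPE(nat) TYPE('m) (R\<lparr>carrier := D\<rparr>)"
begin

text \<open>Productive boundedness of \<open>D\<close> is applied to the modules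
  \<open>r e n L n\<close> with \<open>n \<ge> N\<close>. By unboundedness no nonzero
  \<open>d\<close> in \<open>D\<close> kills almost all of them, so one of them or their product is
  not torsion over \<open>D\<close>; an element witnessing this lifts to \<open>y\<close>. Starting
  the index set at \<open>N\<close> leaves the coordinates below \<open>N\<close> zero.\<close>

lemma D_faithful_element:
  assumes L: "\<And>n. submodule (L n) R (M n)" and e: "\<And>n. e n \<in> carrier R"
    and unb: "unbounded (scaled e L)" and r: "r \<in> carrier R" "r \<noteq> \<zero>"
  obtains y where "\<And>n. y n \<in> L n" "\<And>n. n < N \<Longrightarrow> y n = \<zero>\<^bsub>M n\<^esub>"
    "\<And>d. \<lbrakk>d \<in> D; \<And>n. d \<odot>\<^bsub>M n\<^esub> (r \<odot>\<^bsub>M n\<^esub> (e n \<odot>\<^bsub>M n\<^esub> y n)) = \<zero>\<^bsub>M n\<^esub>\<rbrakk> \<Longrightarrow> d = \<zero>"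
proof -
  note witness = that
  note L_sub = module.submoduleE[OF M L]
  have Lc: "x \<in> carrier (M n)" if "x \<in> L n" for x n using L_sub(1) that by auto
  have L0: "\<zero>\<^bsub>M n\<^esub> \<in> L n" for n
    using subgroup.one_closed[OF submodule.axioms(1)[OF L]] by simp
  define g where "g n x = r \<odot>\<^bsub>M n\<^esub> (e n \<odot>\<^bsub>M n\<^esub> x)" for n x
  define T where "T n = M n\<lparr>carrier := g n ` L n\<rparr>" for n
  let ?D = "R\<lparr>carrier := D\<rparr>"
  interpret D: domain ?D by (rule D_domain)
  have mT: "module ?D (T n)" for n
  proof -
    interpret Mn: module R "M n" by (rule M)
    have "submodule (g n ` L n) R (M n)"
    proof (rule Mn.submoduleI)
      fix a assume "a \<in> g n ` L n"
      then obtain x where x: "x \<in> L n" "a = g n x" by auto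
      then have "\<ominus>\<^bsub>M n\<^esub> a = g n (\<ominus>\<^bsub>M n\<^esub> x)"
        using Lc[OF x(1)] r e[of n] by (simp add: g_def Mn.smult_r_minus)
      then show "\<ominus>\<^bsub>M n\<^esub> a \<in> g n ` L n" using L_sub(3)[OF x(1)] by auto
    next
      fix a b assume "a \<in> g n ` L n" "b \<in> g n ` L n"
      then obtain x y where xy: "x \<in> L n" "a = g n x" "y \<in> L n" "b = g n y" by auto
      then have "a \<oplus>\<^bsub>M n\<^esub> b = g n (x \<oplus>\<^bsub>M n\<^esub> y)"
        using Lc[OF xy(1)] Lc[OF xy(3)] r e[of n] by (simp add: g_def smult_add)
      then show "a \<oplus>\<^bsub>M n\<^esub> b \<in> g n ` L n" using L_sub(5)[OF xy(1,3)] by auto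
    next
      fix c a assume c: "c \<in> carrier R" and "a \<in> g n ` L n"
      then obtain x where x: "x \<in> L n" "a = g n x" by auto
      then have "c \<odot>\<^bsub>M n\<^esub> a = g n (c \<odot>\<^bsub>M n\<^esub> x)"
        using Lc[OF x(1)] r e[of n] c by (simp add: g_def smult_commute[of c])
      then show "c \<odot>\<^bsub>M n\<^esub> a \<in> g n ` L n" using L_sub(4)[OF c x(1)] by auto
    next
      have "g n \<zero>\<^bsub>M n\<^esub> = \<zero>\<^bsub>M n\<^esub>" using r e by (simp add: g_def)
      then show "\<zero>\<^bsub>M n\<^esub> \<in> g n ` L n" using L0[of n] by (metis imageI)
    qed (use Lc r e in \<open>auto simp: g_def\<close>)
    then show ?thesis
      unfolding T_def
      by (intro module_restrict_scalars[OF _ subdomain] submodule.submodule_is_module M)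
  qed
  show ?thesis
  proof (cases "(\<forall>n\<in>{N..}. torsion_module ?D (T n)) \<and> torsion_module ?D (product_module {N..} T)")
    case True
    \<comment> \<open>This case is impossible: a nonzero \<open>d\<close> that kills almost all
      \<open>T n\<close> makes \<open>d \<otimes> r\<close> kill almost all terms of
      \<open>scaled e L\<close>.\<close>
    then obtain J where J: "J \<subseteq> {N..}" "finite ({N..} - J)"
      "carrier ?D \<inter> (\<Inter>n\<in>J. module_ann ?D (T n)) \<noteq> {\<zero>\<^bsub>?D\<^esub>}"
      using bounded_D[unfolded productively_bounded_def, rule_format, of "{N..}" T] by auto
    have "\<zero>\<^bsub>?D\<^esub> \<in> carrier ?D \<inter> (\<Inter>n\<in>J. module_ann ?D (T n))"
      using module.smult_l_null[OF mT] by (auto simp: module_ann_def)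
    then obtain d where d: "d \<in> D" "d \<noteq> \<zero>" "\<And>n. n \<in> J \<Longrightarrow> d \<in> module_ann ?D (T n)"
      using J(3) by auto
    have "d \<otimes> r \<in> carrier R - {\<zero>}" using d(1,2) r integral[of d r] by auto
    then have "\<exists>\<^sub>F n in sequentially. \<exists>x\<in>L n. (d \<otimes> r) \<odot>\<^bsub>M n\<^esub> (e n \<odot>\<^bsub>M n\<^esub> x) \<noteq> \<zero>\<^bsub>M n\<^esub>"
      using unb by (simp add: unbounded_def scaled_def)
    moreover have "\<forall>\<^sub>F n in sequentially. n \<in> J"
    proof -
      have "\<forall>\<^sub>F n in sequentially. n \<notin> {N..} - J"
        unfolding cofinite_eq_sequentially[symmetric] eventually_cofinite not_not Collect_mem_eq by (rule J(2))
      then show ?thesis using eventually_ge_at_top[of N] by eventually_elim auto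
    qed
    ultimately have "\<exists>\<^sub>F n in sequentially. False"
    proof (rule frequently_rev_mp[OF _ eventually_mono])
      fix n assume n: "n \<in> J"
      have "(d \<otimes> r) \<odot>\<^bsub>M n\<^esub> (e n \<odot>\<^bsub>M n\<^esub> x) = \<zero>\<^bsub>M n\<^esub>" if "x \<in> L n" for x
        using d(3)[OF n] that d(1) r e[of n] Lc[OF that]
        by (auto simp: module_ann_def T_def g_def mult_smult)
      then show "(\<exists>x\<in>L n. (d \<otimes> r) \<odot>\<^bsub>M n\<^esub> (e n \<odot>\<^bsub>M n\<^esub> x) \<noteq> \<zero>\<^bsub>M n\<^esub>) \<longrightarrow> False" by blast
    qed
    then show ?thesis by simp
  next
    case False
    \<comment> \<open>A non-torsion element of one \<open>T n\<close> is extended by zero; a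
      non-torsion element of the product is lifted coordinatewise through
      \<open>g n\<close>.\<close>
    then consider (single) n where "n \<in> {N..}" "\<not> torsion_module ?D (T n)"
      | (prod) "\<not> torsion_module ?D (product_module {N..} T)" by blast
    then show ?thesis
    proof cases
      case single
      then obtain x where x: "x \<in> L n" "\<And>d. d \<in> D \<Longrightarrow> d \<noteq> \<zero> \<Longrightarrow> d \<odot>\<^bsub>M n\<^esub> g n x \<noteq> \<zero>\<^bsub>M n\<^esub>"
        using mT by (auto simp: torsion_module_def T_def)
      show ?thesis
      proof (rule witness[of "\<lambda>i. if i = n then x else \<zero>\<^bsub>M i\<^esub>"])
        fix d assume "d \<in> D" and
          *: "\<And>i. d \<odot>\<^bsub>M i\<^esub> (r \<odot>\<^bsub>M i\<^esub> (e i \<odot>\<^bsub>M i\<^esub> (if i = n then x else \<zero>\<^bsub>M i\<^esub>))) = \<zero>\<^bsub>M i\<^esub>"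
        then show "d = \<zero>" using x(2)[of d] *[of n] by (auto simp: g_def)
      qed (use x L0 single in auto)
    next
      case prod
      have "module ?D (product_module {N..} T)"
        by (intro product_module_is_module D.is_cring mT)
      with prod obtain f where f: "f \<in> carrier (product_module {N..} T)"
        "\<And>d. d \<in> D \<Longrightarrow> d \<noteq> \<zero> \<Longrightarrow> d \<odot>\<^bsub>product_module {N..} T\<^esub> f \<noteq> \<zero>\<^bsub>product_module {N..} T\<^esub>"
        by (auto simp: torsion_module_def)
      have "\<exists>x. x \<in> L n \<and> f n = g n x" if "n \<ge> N" for n
        using f(1) that by (auto simp: product_module_def T_def PiE_iff)
      then obtain y where y: "\<And>n. n \<ge> N \<Longrightarrow> y n \<in> L n \<and> f n = g n (y n)" by metis
      show ?thesis
      proof (rule witness[of "\<lambda>i. if i \<ge> N then y i else \<zero>\<^bsub>M i\<^esub>"])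
        fix d assume d: "d \<in> D" and
          *: "\<And>i. d \<odot>\<^bsub>M i\<^esub> (r \<odot>\<^bsub>M i\<^esub> (e i \<odot>\<^bsub>M i\<^esub> (if i \<ge> N then y i else \<zero>\<^bsub>M i\<^esub>))) = \<zero>\<^bsub>M i\<^esub>"
        have "d \<odot>\<^bsub>M i\<^esub> f i = \<zero>\<^bsub>M i\<^esub>" if "i \<ge> N" for i
          using *[of i] y[OF that] that by (simp add: g_def)
        then have "d \<odot>\<^bsub>product_module {N..} T\<^esub> f = \<zero>\<^bsub>product_module {N..} T\<^esub>"
          by (auto simp: product_module_def T_def intro: restrict_ext)
        then show "d = \<zero>" using f(2) d by blast
      qed (use y L0 in auto)
    qed
  qed
qed

lemma annihilated_submodule:
  assumes L: "\<And>n. submodule (L n) R (M n)" and e: "\<And>n. e n \<in> carrier R"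
  shows "submodule (annihilated e L n) R (M n)"
proof -
  interpret Mn: module R "M n" by (rule M)
  note L_sub = Mn.submoduleE[OF L]
  have Lc: "x \<in> carrier (M n)" if "x \<in> L n" for x using L_sub(1) that by auto
  have L0: "\<zero>\<^bsub>M n\<^esub> \<in> L n"
    using subgroup.one_closed[OF submodule.axioms(1)[OF L]] by simp
  show ?thesis
    by (rule Mn.submoduleI)
      (use L_sub Lc L0 e in \<open>auto simp: annihilated_def Mn.smult_r_minus smult_add smult_commute[of "e n"]\<close>)
qed

text \<open>The two halves of \<open>unbounded_splitting\<close> have separate tasks. Unboundedness
  of \<open>scaled e L\<close> yields \<open>y\<close> such that the annihilator of
  \<open>f e y\<close> cuts \<open>A\<close> down to miss one more span; unboundedness of
  \<open>annihilated e L\<close> lets the construction continue there.\<close>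

lemma unbounded_step:
  assumes s: "range s \<subseteq> carrier R"
    and L: "\<And>i. submodule (L i) R (M i)" "unbounded L"
    and f: "f \<in> carrier R" "f \<noteq> \<zero>"
    and A: "D_subspace A" "D_span s n \<inter> A \<subseteq> {\<zero>}"
  obtains e y where "\<And>i. e i \<in> carrier R" "unbounded (annihilated e L)"
    "\<And>i. y i \<in> L i" "\<And>i. i < n \<Longrightarrow> y i = \<zero>\<^bsub>M i\<^esub>"
    "D_subspace (A \<inter> {a \<in> carrier R. \<forall>i. a \<odot>\<^bsub>M i\<^esub> (f \<odot>\<^bsub>M i\<^esub> (e i \<odot>\<^bsub>M i\<^esub> y i)) = \<zero>\<^bsub>M i\<^esub>})"
    "D_span s (Suc n) \<inter>
      (A \<inter> {a \<in> carrier R. \<forall>i. a \<odot>\<^bsub>M i\<^esub> (f \<odot>\<^bsub>M i\<^esub> (e i \<odot>\<^bsub>M i\<^esub> y i)) = \<zero>\<^bsub>M i\<^esub>}) \<subseteq> {\<zero>}"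
proof -
  have Lc: "L i \<subseteq> carrier (M i)" for i using module.submoduleE(1)[OF M L(1)] .
  obtain e where e: "\<And>i. e i \<in> carrier R" "unbounded (scaled e L)" "unbounded (annihilated e L)"
    using unbounded_splitting[OF Lc L(2)] by metis
  obtain r where r: "r \<in> carrier R" "r \<noteq> \<zero>"
    "\<And>B. \<lbrakk>D_subspace B; \<And>d. \<lbrakk>d \<in> D; d \<otimes> r \<in> B\<rbrakk> \<Longrightarrow> d = \<zero>\<rbrakk> \<Longrightarrow> D_span s (Suc n) \<inter> (A \<inter> B) \<subseteq> {\<zero>}"
    using span_meet_step[OF s A] by metis
  \<comment> \<open>The factor \<open>f\<close> isolates the new term from the earlier ones, and
    \<open>r\<close> is the element whose \<open>D\<close>-multiples must avoid the annihilator of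
    \<open>f e y\<close>.\<close>
  have "r \<otimes> f \<in> carrier R" "r \<otimes> f \<noteq> \<zero>" using r f integral[of r f] by auto
  then obtain y where y: "\<And>i. y i \<in> L i" "\<And>i. i < n \<Longrightarrow> y i = \<zero>\<^bsub>M i\<^esub>"
    "\<And>d. \<lbrakk>d \<in> D; \<And>i. d \<odot>\<^bsub>M i\<^esub> ((r \<otimes> f) \<odot>\<^bsub>M i\<^esub> (e i \<odot>\<^bsub>M i\<^esub> y i)) = \<zero>\<^bsub>M i\<^esub>\<rbrakk> \<Longrightarrow> d = \<zero>"
    using D_faithful_element[OF L(1) e(1,2), of "r \<otimes> f" n] by metis
  define z where "z i = f \<odot>\<^bsub>M i\<^esub> (e i \<odot>\<^bsub>M i\<^esub> y i)" for i
  have ey: "e i \<odot>\<^bsub>M i\<^esub> y i \<in> carrier (M i)" for i using y(1)[of i] Lc[of i] e(1) by auto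
  then have z: "z i \<in> carrier (M i)" for i using f(1) by (auto simp: z_def)
  define B where "B = {a \<in> carrier R. \<forall>i. a \<odot>\<^bsub>M i\<^esub> z i = \<zero>\<^bsub>M i\<^esub>}"
  have B: "D_subspace B"
    unfolding D_subspace_def using z by (auto simp: B_def add_smult mult_smult)
  have "d = \<zero>" if "d \<in> D" "d \<otimes> r \<in> B" for d
  proof (rule y(3)[OF that(1)])
    fix i
    have "d \<odot>\<^bsub>M i\<^esub> ((r \<otimes> f) \<odot>\<^bsub>M i\<^esub> (e i \<odot>\<^bsub>M i\<^esub> y i)) = (d \<otimes> r) \<odot>\<^bsub>M i\<^esub> z i"
      using that(1) r(1) f(1) ey[of i] by (simp add: z_def mult_smult)
    then show "d \<odot>\<^bsub>M i\<^esub> ((r \<otimes> f) \<odot>\<^bsub>M i\<^esub> (e i \<odot>\<^bsub>M i\<^esub> y i)) = \<zero>\<^bsub>M i\<^esub>"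
      using that(2) by (simp add: B_def)
  qed
  then have "D_span s (Suc n) \<inter> (A \<inter> B) \<subseteq> {\<zero>}" using r(3) B by blast
  moreover have "D_subspace (A \<inter> B)"
    using A(1) B by (auto simp: D_subspace_def)
  ultimately show ?thesis
    using that[of e y] e y(1,2) by (simp add: B_def z_def)
qed

text \<open>The sum \<open>w\<close> of the chosen \<open>y n\<close> is finite in each coordinate.
  If \<open>a\<close> kills \<open>w\<close>, multiplication by \<open>f n\<close> and
  \<open>e n\<close> shows that \<open>a\<close> kills \<open>f n e n y n\<close>:
  \<open>f n\<close> removes the earlier terms and \<open>e n\<close> the later ones. So
  \<open>a\<close> lies in every \<open>A n\<close>, which meets \<open>D_span s n\<close> in zero.
  As the spans exhaust \<open>R\<close>, \<open>a\<close> is zero, although the product is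
  torsion.\<close>

lemma not_unbounded_carrier:
  assumes s: "range s \<subseteq> carrier R" "carrier R = (\<Union>n. D_span s n)"
  shows "\<not> unbounded (\<lambda>n. carrier (M n))"
proof
  assume unb: "unbounded (\<lambda>n. carrier (M n))"
  define B where "B f e y = {a \<in> carrier R. \<forall>i. a \<odot>\<^bsub>M i\<^esub> (f \<odot>\<^bsub>M i\<^esub> (e i \<odot>\<^bsub>M i\<^esub> y i)) = \<zero>\<^bsub>M i\<^esub>}"
    for f e and y :: "nat \<Rightarrow> 'm"
  \<comment> \<open>\<open>w\<close> is the current partial sum, \<open>f\<close> annihilates it, and \<open>A\<close> bounds the annihilator of the
    limit.\<close>
  define P where "P n = (\<lambda>(L, f, A, w). (\<forall>i. submodule (L i) R (M i)) \<and> unbounded L \<and>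
      f \<in> carrier R \<and> f \<noteq> \<zero> \<and> D_subspace A \<and> D_span s n \<inter> A \<subseteq> {\<zero>} \<and>
      (\<forall>i. w i \<in> carrier (M i)) \<and> (\<forall>i. f \<odot>\<^bsub>M i\<^esub> w i = \<zero>\<^bsub>M i\<^esub>))" for n
  define Q where "Q n = (\<lambda>(L, f, A, w) (L', f' :: 'a, A', w').
      \<exists>e y. (\<forall>i. e i \<in> carrier R) \<and> (\<forall>i. y i \<in> L i) \<and> (\<forall>i<n. y i = \<zero>\<^bsub>M i\<^esub>) \<and>
        (\<forall>i. w' i = w i \<oplus>\<^bsub>M i\<^esub> y i) \<and> L' = annihilated e L \<and> A' = A \<inter> B f e y)" for n
  have "\<exists>st. (\<forall>n. P n (st n) \<and> Q n (st n) (st (Suc n))) \<and> st 0 = ((\<lambda>n. carrier (M n)), \<one>, carrier R, \<lambda>i. \<zero>\<^bsub>M i\<^esub>)"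
  proof -
    let ?st0 = "((\<lambda>n. carrier (M n)), \<one>, carrier R, \<lambda>i. \<zero>\<^bsub>M i\<^esub>)"
    \<comment> \<open>The second conjunct fixes the initial state, which dependent choice alone
      would leave open.\<close>
    have "\<exists>st. \<forall>n. (P n (st n) \<and> (n = 0 \<longrightarrow> st n = ?st0)) \<and> Q n (st n) (st (Suc n))"
    proof (rule dependent_nat_choice)
      show "\<exists>st. P 0 st \<and> (0 = (0::nat) \<longrightarrow> st = ?st0)"
        using unb module.carrier_is_submodule[OF M]
        by (intro exI[of _ ?st0]) (auto simp: P_def D_subspace_def)
    next
      fix st n assume "P n st \<and> (n = 0 \<longrightarrow> st = ?st0)"
      then have P: "P n st" by simp
      obtain L f A w where st: "st = (L, f, A, w)" by (cases st)
      have L: "\<And>i. submodule (L i) R (M i)" "unbounded L"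
        and f: "f \<in> carrier R" "f \<noteq> \<zero>"
        and A: "D_subspace A" "D_span s n \<inter> A \<subseteq> {\<zero>}"
        and w: "\<And>i. w i \<in> carrier (M i)" "\<And>i. f \<odot>\<^bsub>M i\<^esub> w i = \<zero>\<^bsub>M i\<^esub>"
        using P by (auto simp: P_def st)
      obtain e y where e: "\<And>i. e i \<in> carrier R" "unbounded (annihilated e L)"
        and y: "\<And>i. y i \<in> L i" "\<And>i. i < n \<Longrightarrow> y i = \<zero>\<^bsub>M i\<^esub>"
        and AB: "D_subspace (A \<inter> B f e y)" "D_span s (Suc n) \<inter> (A \<inter> B f e y) \<subseteq> {\<zero>}"
        by (rule unbounded_step[OF s(1) L f A, folded B_def]) (rule that)
      have yc: "y i \<in> carrier (M i)" for i using module.submoduleE(1)[OF M L(1)] y(1) by auto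
      \<comment> \<open>The new term has its own nonzero annihilator \<open>g\<close>, so
        \<open>f \<otimes> g\<close> is a nonzero annihilator of the next partial sum.\<close>
      then obtain g where g: "g \<in> carrier R" "g \<noteq> \<zero>" "\<And>i. g \<odot>\<^bsub>M i\<^esub> y i = \<zero>\<^bsub>M i\<^esub>"
        using torsion[of y] by auto
      define w' where "w' i = w i \<oplus>\<^bsub>M i\<^esub> y i" for i
      have "(f \<otimes> g) \<odot>\<^bsub>M i\<^esub> w' i = \<zero>\<^bsub>M i\<^esub>" for i
      proof -
        have "(f \<otimes> g) \<odot>\<^bsub>M i\<^esub> w' i = g \<odot>\<^bsub>M i\<^esub> (f \<odot>\<^bsub>M i\<^esub> w i) \<oplus>\<^bsub>M i\<^esub> f \<odot>\<^bsub>M i\<^esub> (g \<odot>\<^bsub>M i\<^esub> y i)"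
          using f(1) g(1) w(1)[of i] yc[of i]
          by (simp add: w'_def mult_smult smult_add smult_commute[of f g])
        then show ?thesis using f(1) g(1,3) w(2) by simp
      qed
      moreover have "f \<otimes> g \<noteq> \<zero>" using f g integral by blast
      ultimately have "P (Suc n) (annihilated e L, f \<otimes> g, A \<inter> B f e y, w')"
        using annihilated_submodule[OF L(1) e(1)] e(2) AB f(1) g(1) w(1) yc
        by (auto simp: P_def w'_def)
      moreover have "Q n st (annihilated e L, f \<otimes> g, A \<inter> B f e y, w')"
        using e(1) y by (auto simp: Q_def st w'_def)
      ultimately show "\<exists>st'. (P (Suc n) st' \<and> (Suc n = 0 \<longrightarrow> st' = ?st0)) \<and> Q n st st'" by blast
    qed
    then show ?thesis by blast
  qed
  then obtain st where st: "\<And>n. P n (st n)" "\<And>n. Q n (st n) (st (Suc n))"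
    "st 0 = ((\<lambda>n. carrier (M n)), \<one>, carrier R, \<lambda>i. \<zero>\<^bsub>M i\<^esub>)" by blast
  define L f A w where "L n = fst (st n)" and "f n = fst (snd (st n))"
    and "A n = fst (snd (snd (st n)))" and "w n = snd (snd (snd (st n)))" for n
  have st_eq: "st n = (L n, f n, A n, w n)" for n by (simp add: L_def f_def A_def w_def)
  have sub: "submodule (L n i) R (M i)" and f: "f n \<in> carrier R" "f n \<noteq> \<zero>"
    and VA: "D_span s n \<inter> A n \<subseteq> {\<zero>}"
    and w: "w n i \<in> carrier (M i)" "f n \<odot>\<^bsub>M i\<^esub> w n i = \<zero>\<^bsub>M i\<^esub>" for n i
    using st(1)[of n] by (auto simp: P_def st_eq)
  have "\<exists>e y. (\<forall>i. e i \<in> carrier R) \<and> (\<forall>i. y i \<in> L n i) \<and> (\<forall>i<n. y i = \<zero>\<^bsub>M i\<^esub>) \<and>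
      (\<forall>i. w (Suc n) i = w n i \<oplus>\<^bsub>M i\<^esub> y i) \<and> L (Suc n) = annihilated e (L n) \<and>
      A (Suc n) = A n \<inter> B (f n) e y" for n
    using st(2)[of n] by (simp add: Q_def st_eq)
  then obtain e y where e: "\<And>n i. e n i \<in> carrier R" and y: "\<And>n i. y n i \<in> L n i"
    and y0: "\<And>n i. i < n \<Longrightarrow> y n i = \<zero>\<^bsub>M i\<^esub>"
    and w_Suc: "\<And>n i. w (Suc n) i = w n i \<oplus>\<^bsub>M i\<^esub> y n i"
    and L_Suc: "\<And>n. L (Suc n) = annihilated (e n) (L n)"
    and A_Suc: "\<And>n. A (Suc n) = A n \<inter> B (f n) (e n) (y n)"
    by metis
  have Lc: "L n i \<subseteq> carrier (M i)" for n i using module.submoduleE(1)[OF M sub] .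
  have yc: "y n i \<in> carrier (M i)" for n i using y Lc by blast
  have L_anti: "L m i \<subseteq> L n i" if "n \<le> m" for m n i
    using that by (induction rule: dec_induct) (auto simp: L_Suc annihilated_def)
  \<comment> \<open>Terms with index above \<open>i\<close> vanish in coordinate \<open>i\<close>,
    so the partial sums are constant there from \<open>Suc i\<close> on.\<close>
  have w_const: "w m i = w (Suc i) i" if "Suc i \<le> m" for m i
    using that by (induction rule: dec_induct) (auto simp: w_Suc y0 yc w(1))
  \<comment> \<open>At \<open>m = Suc n\<close> the earlier terms are gone because
    \<open>f n\<close> kills \<open>w n\<close>. Each later \<open>y m\<close> lies in
    \<open>L (Suc n)\<close>, which \<open>e n\<close> kills.\<close>
  have w_lead: "f n \<odot>\<^bsub>M i\<^esub> (e n i \<odot>\<^bsub>M i\<^esub> w m i) = f n \<odot>\<^bsub>M i\<^esub> (e n i \<odot>\<^bsub>M i\<^esub> y n i)"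
    if "Suc n \<le> m" for m n i
    using that
  proof (induction rule: dec_induct)
    case base
    have "f n \<odot>\<^bsub>M i\<^esub> (e n i \<odot>\<^bsub>M i\<^esub> w n i) = \<zero>\<^bsub>M i\<^esub>"
      using f(1) e w smult_commute[of "f n" "e n i" "w n i" i] by simp
    then show ?case using f(1)[of n] e[of n i] w(1)[of n i] yc[of n i] by (simp add: w_Suc smult_add)
  next
    case (step m)
    have "y m i \<in> annihilated (e n) (L n) i"
      using y[of m i] L_anti[OF step(1), of i] L_Suc[of n] by auto
    then show ?case
      using step.IH f(1)[of n] e[of n i] w(1)[of m i] yc[of m i]
      by (simp add: w_Suc smult_add annihilated_def)
  qed
  \<comment> \<open>The limit of the partial sums has \<open>w (Suc i) i\<close> as its coordinate
    at \<open>i\<close>.\<close>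
  obtain a where a: "a \<in> carrier R" "a \<noteq> \<zero>" "\<And>i. a \<odot>\<^bsub>M i\<^esub> w (Suc i) i = \<zero>\<^bsub>M i\<^esub>"
    using torsion[of "\<lambda>i. w (Suc i) i"] w(1) by auto
  have "a \<in> B (f n) (e n) (y n)" for n
  proof -
    have "a \<odot>\<^bsub>M i\<^esub> (f n \<odot>\<^bsub>M i\<^esub> (e n i \<odot>\<^bsub>M i\<^esub> y n i)) = \<zero>\<^bsub>M i\<^esub>" for i
    \<comment> \<open>For \<open>i < n\<close> the term is zero; otherwise
      \<open>Suc n \<le> Suc i\<close>, and \<open>w_lead\<close> applies to the final value
      \<open>w (Suc i) i\<close>.\<close>
    proof (cases "i < n")
      case True
      then show ?thesis using y0 a(1) f(1)[of n] e[of n i] by simp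
    next
      case False
      then have "f n \<odot>\<^bsub>M i\<^esub> (e n i \<odot>\<^bsub>M i\<^esub> w (Suc i) i) = f n \<odot>\<^bsub>M i\<^esub> (e n i \<odot>\<^bsub>M i\<^esub> y n i)"
        by (intro w_lead) simp
      then have "a \<odot>\<^bsub>M i\<^esub> (f n \<odot>\<^bsub>M i\<^esub> (e n i \<odot>\<^bsub>M i\<^esub> y n i)) =
          f n \<odot>\<^bsub>M i\<^esub> (e n i \<odot>\<^bsub>M i\<^esub> (a \<odot>\<^bsub>M i\<^esub> w (Suc i) i))"
        using a(1) f(1)[of n] e[of n i] w(1)[of "Suc i" i] smult_commute[of a "f n" "e n i \<odot>\<^bsub>M i\<^esub> w (Suc i) i" i]
          smult_commute[of a "e n i" "w (Suc i) i" i] by simp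
      then show ?thesis using a(3) f(1) e by simp
    qed
    then show ?thesis using a(1) by (simp add: B_def)
  qed
  moreover have "A 0 = carrier R" using st(3) by (simp add: A_def)
  ultimately have "a \<in> A n" for n by (induction n) (use a(1) A_Suc in auto)
  moreover obtain n where "a \<in> D_span s n" using a(1) s(2) by auto
  ultimately show False using VA[of n] a(2) by auto
qed

end

lemma module_ann_ideal:
  assumes "module A M"
  shows "ideal (module_ann A M) A"
proof -
  interpret module A M by fact
  show ?thesis
    by (rule R.idealI_cring) (auto simp: module_ann_def smult_l_distr smult_assoc1)
qed

subsection \<open>Ascent of productive boundedness\<close>

text \<open>Suppose that every countable \<open>C\<close> fails. Then only finitely many ideals are
  zero, as infinitely many would give a countable witness. Among the other indices, each countable
  family has a nonzero \<open>r\<close> missing only finitely many of its ideals, and multiplying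
  \<open>r\<close> by nonzero members of these gives a common element. Compactness extends this to
  all indices outside the finite set \<open>Z\<close>, against \<open>inf\<close>.\<close>

lemma countable_unbounded_subfamily:
  assumes A: "domain A" "countable_meets_suffice A"
    and a: "\<And>i. i \<in> I \<Longrightarrow> ideal (a i) A"
    and inf: "\<And>r. \<lbrakk>r \<in> carrier A; r \<noteq> \<zero>\<^bsub>A\<^esub>\<rbrakk> \<Longrightarrow> infinite {i \<in> I. r \<notin> a i}"
  obtains C where "C \<subseteq> I" "countable C"
    "\<And>r. \<lbrakk>r \<in> carrier A; r \<noteq> \<zero>\<^bsub>A\<^esub>\<rbrakk> \<Longrightarrow> infinite {i \<in> C. r \<notin> a i}"
proof (rule ccontr)
  note witness = that
  assume no: "\<not> thesis"
  interpret A: domain A by fact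
  define Z where "Z = {i \<in> I. \<forall>r\<in>carrier A - {\<zero>\<^bsub>A\<^esub>}. r \<notin> a i}"
  have "finite Z"
  proof (rule ccontr)
    assume "infinite Z"
    then obtain C where C: "C \<subseteq> Z" "infinite C" "countable C"
      using infinite_countable_subset'[of Z] by blast
    have "{i \<in> C. r \<notin> a i} = C" if "r \<in> carrier A" "r \<noteq> \<zero>\<^bsub>A\<^esub>" for r
      using that C(1) by (auto simp: Z_def)
    then show False using no witness[of C] C by (auto simp: Z_def)
  qed
  have nz: "\<exists>r\<in>carrier A - {\<zero>\<^bsub>A\<^esub>}. \<forall>i\<in>C. r \<in> a i" if C: "C \<subseteq> I - Z" "countable C" for C
  proof -
    obtain r where r: "r \<in> carrier A" "r \<noteq> \<zero>\<^bsub>A\<^esub>" "finite {i \<in> C. r \<notin> a i}"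
      using no witness[of C] C by blast
    \<comment> \<open>Finitely many nonzero ideals of a domain share a nonzero element, the product
      of nonzero members.\<close>
    have "\<exists>u\<in>carrier A - {\<zero>\<^bsub>A\<^esub>}. \<forall>i\<in>F. u \<in> a i" if "finite F" "F \<subseteq> C" for F
      using that
    proof (induction F)
      case empty
      then show ?case using A.one_closed A.one_not_zero by blast
    next
      case (insert j F)
      then obtain u where u: "u \<in> carrier A" "u \<noteq> \<zero>\<^bsub>A\<^esub>" "\<forall>i\<in>F. u \<in> a i" by auto
      obtain v where v: "v \<in> carrier A" "v \<noteq> \<zero>\<^bsub>A\<^esub>" "v \<in> a j"
        using insert.prems C(1) unfolding Z_def by blast
      have "u \<otimes>\<^bsub>A\<^esub> v \<noteq> \<zero>\<^bsub>A\<^esub>" using u v A.integral by blast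
      moreover have "u \<otimes>\<^bsub>A\<^esub> v \<in> a i" if "i \<in> insert j F" for i
      proof -
        have "i \<in> I" using that insert.prems C(1) by auto
        then show ?thesis
          using that u v ideal.I_l_closed[OF a] ideal.I_r_closed[OF a] by auto
      qed
      ultimately show ?case using u(1) v(1) by blast
    qed
    then obtain u where u: "u \<in> carrier A" "u \<noteq> \<zero>\<^bsub>A\<^esub>" "\<forall>i\<in>{i \<in> C. r \<notin> a i}. u \<in> a i"
      using r(3) by blast
    have "r \<otimes>\<^bsub>A\<^esub> u \<noteq> \<zero>\<^bsub>A\<^esub>" using r u A.integral by blast
    moreover have "r \<otimes>\<^bsub>A\<^esub> u \<in> a i" if "i \<in> C" for i
    proof -
      have "i \<in> I" using that C(1) by auto
      then show ?thesis
        using that r u ideal.I_l_closed[OF a] ideal.I_r_closed[OF a] by (cases "r \<in> a i") auto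
    qed
    ultimately show ?thesis using r(1) u(1) by blast
  qed
  obtain r where r: "r \<in> carrier A" "r \<noteq> \<zero>\<^bsub>A\<^esub>" "\<And>i. i \<in> I - Z \<Longrightarrow> r \<in> a i"
    by (rule countable_meets_sufficeD[OF A(2), of "I - Z" a]) (use a nz in auto)
  then have "{i \<in> I. r \<notin> a i} \<subseteq> Z" by auto
  then show False using inf[OF r(1,2)] \<open>finite Z\<close> finite_subset by blast
qed

theorem theorem10:
  fixes R :: "('a, 'c) ring_scheme" and D S :: "'a set"
  assumes "domain R"
    and "subdomain D R"
    and "S \<subseteq> carrier R" and "countable S" and "carrier R = generate_ring R (D \<union> S)"
    and "productively_bounded TYPE('a) TYPE('a) (R\<lparr>carrier := D\<rparr>)"
  shows "productively_bounded TYPE('i) TYPE('m) R"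
  unfolding productively_bounded_def
proof (intro allI impI, elim conjE)
  interpret domain_extension R D
    by (intro domain_extension.intro domain_extension_axioms.intro assms)
  \<comment> \<open>Two further instances are needed over \<open>D\<close>: modules of functions on
    sets of cosets for the compactness property, and modules with elements of type \<open>'m\<close>
    for the sequence argument, both indexed by naturals.\<close>
  note pb = productively_bounded_universe[OF D_domain assms(6)]
  obtain s where s: "range s \<subseteq> carrier R" "carrier R = (\<Union>n. D_span s n)"
    using spanning_sequence[OF assms(3,4,5)] by blast
  have meets: "countable_meets_suffice R"
    by (rule countable_meets_suffice_extension[OF _ s])
      (rule countable_meets_suffice_if_productively_bounded[OF D_domain pb])
  fix I :: "'i set" and M :: "'i \<Rightarrow> ('a, 'm) module"
  assume tM: "\<forall>i\<in>I. torsion_module R (M i)" and tP: "torsion_module R (product_module I M)"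
  have mM: "module R (M i)" if "i \<in> I" for i using tM that by (auto simp: torsion_module_def)
  show "\<exists>J\<subseteq>I. finite (I - J) \<and> carrier R \<inter> (\<Inter>i\<in>J. module_ann R (M i)) \<noteq> {\<zero>\<^bsub>R\<^esub>}"
  proof (rule ccontr)
    assume no: "\<not> ?thesis"
    have inf: "infinite {i \<in> I. r \<notin> module_ann R (M i)}" if r: "r \<in> carrier R" "r \<noteq> \<zero>\<^bsub>R\<^esub>" for r
    proof
      assume "finite {i \<in> I. r \<notin> module_ann R (M i)}"
      moreover have "I - {i \<in> I. r \<in> module_ann R (M i)} = {i \<in> I. r \<notin> module_ann R (M i)}" by auto
      ultimately have "finite (I - {i \<in> I. r \<in> module_ann R (M i)})" by simp
      moreover have "r \<in> carrier R \<inter> (\<Inter>i\<in>{i \<in> I. r \<in> module_ann R (M i)}. module_ann R (M i))"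
        using r by auto
      ultimately show False using no r(2) by (metis (no_types, lifting) mem_Collect_eq singletonD subsetI)
    qed
    obtain C where C: "C \<subseteq> I" "countable C"
      "\<And>r. \<lbrakk>r \<in> carrier R; r \<noteq> \<zero>\<^bsub>R\<^esub>\<rbrakk> \<Longrightarrow> infinite {i \<in> C. r \<notin> module_ann R (M i)}"
      by (rule countable_unbounded_subfamily[OF assms(1) meets module_ann_ideal[OF mM] inf]) (assumption | rule that)+
    have "infinite C"
      using C(3)[OF one_closed one_not_zero] by auto
    define g where "g = from_nat_into C"
    have g: "bij_betw g UNIV C"
      unfolding g_def using C(2) \<open>infinite C\<close> by (rule bij_betw_from_nat_into)
    then have gI: "g n \<in> I" and gC: "g n \<in> C" for n using C(1) bij_betwE by blast+
    have g_inv: "the_inv g (g n) = n" for n using g by (simp add: bij_betw_def the_inv_f_f)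
    interpret torsion_sequence_extension R "\<lambda>n. M (g n)" D
    proof (intro torsion_sequence_extension.intro torsion_sequence.intro
        torsion_sequence_axioms.intro torsion_sequence_extension_axioms.intro)
      fix x assume x: "\<And>n. x n \<in> carrier (M (g n))"
      \<comment> \<open>A sequence over the enumerated \<open>C\<close> becomes an element of the
        full product by setting the coordinates outside \<open>C\<close> to zero, so the torsion
        hypothesis over \<open>I\<close> applies to it.\<close>
      define f where "f = (\<lambda>i\<in>I. if i \<in> C then x (the_inv g i) else \<zero>\<^bsub>M i\<^esub>)"
      have "f i \<in> carrier (M i)" if "i \<in> I" for i
      proof (cases "i \<in> C")
        case True
        then obtain n where "i = g n" using g by (auto simp: bij_betw_def)
        then show ?thesis using x[of n] gI gC g_inv by (simp add: f_def)
      next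
        case False
        interpret module R "M i" by (rule mM[OF that])
        show ?thesis using False that by (simp add: f_def)
      qed
      then have "f \<in> carrier (product_module I M)" by (auto simp: product_module_def f_def)
      then obtain r where r: "r \<in> carrier R - {\<zero>\<^bsub>R\<^esub>}"
        "r \<odot>\<^bsub>product_module I M\<^esub> f = \<zero>\<^bsub>product_module I M\<^esub>"
        using tP unfolding torsion_module_def by blast
      have "r \<odot>\<^bsub>M (g n)\<^esub> x n = \<zero>\<^bsub>M (g n)\<^esub>" for n
        using fun_cong[OF r(2), of "g n"] gI gC by (simp add: product_module_def f_def g_inv)
      with r(1) show "\<exists>r\<in>carrier R - {\<zero>\<^bsub>R\<^esub>}. \<forall>n. r \<odot>\<^bsub>M (g n)\<^esub> x n = \<zero>\<^bsub>M (g n)\<^esub>" by blast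
    qed (use mM gI meets pb domain_axioms domain_extension_axioms in auto)
    have "unbounded (\<lambda>n. carrier (M (g n)))"
      unfolding unbounded_def
    proof
      fix r assume r: "r \<in> carrier R - {\<zero>\<^bsub>R\<^esub>}"
      have "{i \<in> C. r \<notin> module_ann R (M i)} = g ` {n. r \<notin> module_ann R (M (g n))}"
        using g by (auto simp: bij_betw_def)
      then have "infinite {n. r \<notin> module_ann R (M (g n))}" using C(3)[of r] r by auto
      then have "\<exists>\<^sub>F n in sequentially. r \<notin> module_ann R (M (g n))"
        by (simp add: frequently_cofinite flip: cofinite_eq_sequentially)
      then show "\<exists>\<^sub>F n in sequentially. \<exists>x\<in>carrier (M (g n)). r \<odot>\<^bsub>M (g n)\<^esub> x \<noteq> \<zero>\<^bsub>M (g n)\<^esub>"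
        using r by (elim frequently_elim1) (auto simp: module_ann_def)
    qed
    then show False using not_unbounded_carrier[OF s] by blast
  qed
qed

end
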